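(* Let $G$ be a Garside group and $H$ an abelian subgroup of $G$. Then there exists an element $g\in G$ such that $g^{-1}Hg$ consists of ultra summit elements, i.e. every element of $g^{-1}Hg$ is an ultra summit element of $G$.
   Context: Garside monoids and groups. Let $M$ be a monoid. An atom is an element $a\in M\setminus\{1\}$ such that $a=bc$ implies $b=1$ or $c=1$. For $a\in M$, $|a|_{\max}$ is the supremum of the lengths of all expressions of $a$ in terms of atoms. $M$ is atomic if it is generated by its atoms and $|a|_{\max}<\infty$ for all $a\in M$. In an atomic monoid, $a\le_L b$ means $ac=b$ for some $c\in M$, and $a\le_R b$ means $ca=b$ for some $c\in M$; these are partial orders. A finitely generated monoid $M$ is a Garside monoid if it is atomic, left and right cancellative, the posets $(M,\le_L)$ and $(M,\le_R)$ are lattices, and there is an element $\Delta\in M$ (a Garside element) such that for every $a\in M$, $a\le_L\Delta$ iff $a\le_R\Delta$, and $\{a\in M: a\le_L\Delta\}$ generates $M$. A Garside group $G$ is the group of fractions of a Garside monoid $M$ (which embeds in $G$); write $G^+=M$, and fix the Garside element $\Delta$. Let $\mathcal D=\{a\in G^+: a\le_L\Delta\}$ (simple elements). The orders extend to $G$: $g\le_L h$ iff $gc=h$ for some $c\in G^+$, $g\le_R h$ iff $cg=h$ for some $c\in G^+$; they are lattice orders on $G$, and $\wedge_L$ is the gcd (meet) for $\le_L$. Put $\tau(g)=\Delta^{-1}g\Delta$. For $g\in G$: $\inf(g)=\max\{r\in\mathbb Z:\Delta^r\le_L g\}$, $\sup(g)=\min\{s\in\mathbb Z: g\le_L\Delta^s\}$.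 Every $g$ has a unique expression (normal form) $g=\Delta^r s_1\cdots s_k$ with $s_i\in\mathcal D\setminus\{1,\Delta\}$ and $(s_is_{i+1}\cdots s_k)\wedge_L\Delta=s_i$ for all $i$. The cycling of $g$ is $\mathbf c(g)=\Delta^r s_2\cdots s_k\tau^{-r}(s_1)$ (with the convention $\mathbf c(g)=g$ if $k=0$). Let $[g]$ be the conjugacy class of $g$ in $G$, $\inf_s(g)=\max\{\inf(h):h\in[g]\}$, $\sup_s(g)=\min\{\sup(h):h\in[g]\}$. The super summit set is $[g]^S=\{h\in[g]:\inf(h)=\inf_s(g),\ \sup(h)=\sup_s(g)\}$ and the ultra summit set is $[g]^U=\{h\in[g]^S:\mathbf c^k(h)=h\text{ for some }k\ge1\}$. An element $h$ is a super (resp. ultra) summit element if $h\in[h]^S$ (resp. $h\in[h]^U$). *)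

theory Defs
  imports "HOL-Algebra.Algebra" "HOL-Library.Extended_Nat"
begin

section \<open>Monoids, atoms and divisibility\<close>

definition mprod :: "('a, 'b) monoid_scheme \<Rightarrow> 'a list \<Rightarrow> 'a"
  where "mprod M as = foldr (\<otimes>\<^bsub>M\<^esub>) as \<one>\<^bsub>M\<^esub>"

definition monoid_generated_by :: "('a, 'b) monoid_scheme \<Rightarrow> 'a set \<Rightarrow> bool"
  where "monoid_generated_by M S \<longleftrightarrow>
    S \<subseteq> carrier M \<and> (\<forall>a\<in>carrier M. \<exists>as. set as \<subseteq> S \<and> mprod M as = a)"

definition finitely_generated_monoid :: "('a, 'b) monoid_scheme \<Rightarrow> bool"
  where "finitely_generated_monoid M \<longleftrightarrow> (\<exists>S. finite S \<and> monoid_generated_by M S)"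

definition atoms :: "('a, 'b) monoid_scheme \<Rightarrow> 'a set"
  where "atoms M = {a \<in> carrier M - {\<one>\<^bsub>M\<^esub>}.
    \<forall>b\<in>carrier M. \<forall>c\<in>carrier M. a = b \<otimes>\<^bsub>M\<^esub> c \<longrightarrow> b = \<one>\<^bsub>M\<^esub> \<or> c = \<one>\<^bsub>M\<^esub>}"

definition max_atom_length :: "('a, 'b) monoid_scheme \<Rightarrow> 'a \<Rightarrow> enat"
  where "max_atom_length M a =
    Sup {enat (length as) | as. set as \<subseteq> atoms M \<and> mprod M as = a}"

definition atomic_monoid :: "('a, 'b) monoid_scheme \<Rightarrow> bool"
  where "atomic_monoid M \<longleftrightarrow>
    monoid_generated_by M (atoms M) \<and> (\<forall>a\<in>carrier M. max_atom_length M a < \<infinity>)"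

text \<open>
  The orders are taken relative to a set \<open>P\<close> of admissible quotients, so that the same definition
  gives the divisibility orders of a monoid (\<open>P\<close> its carrier) and their extensions to a group
  containing the monoid \<open>P\<close>.
\<close>

definition le_left :: "('a, 'b) monoid_scheme \<Rightarrow> 'a set \<Rightarrow> 'a \<Rightarrow> 'a \<Rightarrow> bool"
  where "le_left G P a b \<longleftrightarrow> (\<exists>c\<in>P. a \<otimes>\<^bsub>G\<^esub> c = b)"

definition le_right :: "('a, 'b) monoid_scheme \<Rightarrow> 'a set \<Rightarrow> 'a \<Rightarrow> 'a \<Rightarrow> bool"
  where "le_right G P a b \<longleftrightarrow> (\<exists>c\<in>P. c \<otimes>\<^bsub>G\<^esub> a = b)"

definition left_order :: "('a, 'b) monoid_scheme \<Rightarrow> 'a set \<Rightarrow> 'a gorder"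
  where "left_order G P = \<lparr>carrier = carrier G, eq = (=), le = le_left G P\<rparr>"

definition right_order :: "('a, 'b) monoid_scheme \<Rightarrow> 'a set \<Rightarrow> 'a gorder"
  where "right_order G P = \<lparr>carrier = carrier G, eq = (=), le = le_right G P\<rparr>"


section \<open>Garside monoids and Garside groups\<close>

locale garside_monoid = monoid_cancel M for M (structure) +
  fixes \<Delta>
  assumes finitely_generated: "finitely_generated_monoid M"
    and atomic: "atomic_monoid M"
    and lattice_left: "lattice (left_order M (carrier M))"
    and lattice_right: "lattice (right_order M (carrier M))"
    and Delta_closed: "\<Delta> \<in> carrier M"
    and Delta_balanced: "\<And>a. a \<in> carrier M \<Longrightarrow>
          le_left M (carrier M) a \<Delta> \<longleftrightarrow> le_right M (carrier M) a \<Delta>"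
    and Delta_generates: "monoid_generated_by M {a \<in> carrier M. le_left M (carrier M) a \<Delta>}"

text \<open>
  The Garside monoid is identified with its image \<open>P\<close> in its group of fractions \<open>G\<close>.
\<close>

locale garside_group = group G for G (structure) +
  fixes P and \<Delta>
  assumes submonoid: "submonoid P G"
    and garside: "garside_monoid (G\<lparr>carrier := P\<rparr>) \<Delta>"
    and fractions: "\<And>g. g \<in> carrier G \<Longrightarrow> \<exists>a\<in>P. \<exists>b\<in>P. g = inv a \<otimes> b"
begin

definition simples :: "'a set"
  where "simples = {a \<in> P. le_left G P a \<Delta>}"

definition tau :: "'a \<Rightarrow> 'a"
  where "tau g = inv \<Delta> \<otimes> g \<otimes> \<Delta>"

definition tau_pow :: "int \<Rightarrow> 'a \<Rightarrow> 'a"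
  where "tau_pow r g = inv (\<Delta> [^] r) \<otimes> g \<otimes> \<Delta> [^] r"

text \<open>\<open>tau_pow\<close> is the family of integer powers of the automorphism \<open>tau\<close>.\<close>

lemma Delta_in_carrier: "\<Delta> \<in> carrier G"
  using garside submonoid garside_monoid.Delta_closed submonoid.subset by fastforce

lemma tau_pow_1: "tau_pow 1 g = tau g"
  using Delta_in_carrier by (simp add: tau_pow_def tau_def int_pow_1)

lemma tau_pow_add:
  assumes "g \<in> carrier G"
  shows "tau_pow (r + s) g = tau_pow r (tau_pow s g)"
proof -
  have "\<Delta> [^] (r + s) = \<Delta> [^] s \<otimes> \<Delta> [^] r"
    using Delta_in_carrier by (metis add.commute int_pow_mult)
  then show ?thesis
    using assms Delta_in_carrier by (simp add: tau_pow_def inv_mult_group m_assoc)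
qed

definition inf_exp :: "'a \<Rightarrow> int"
  where "inf_exp g = (GREATEST r. le_left G P (\<Delta> [^] r) g)"

definition sup_exp :: "'a \<Rightarrow> int"
  where "sup_exp g = (LEAST s. le_left G P g (\<Delta> [^] s))"

definition normal_form :: "'a \<Rightarrow> int \<Rightarrow> 'a list \<Rightarrow> bool"
  where "normal_form g r ss \<longleftrightarrow>
    set ss \<subseteq> simples - {\<one>, \<Delta>} \<and>
    g = \<Delta> [^] r \<otimes> mprod G ss \<and>
    (\<forall>i<length ss. mprod G (drop i ss) \<sqinter>\<^bsub>left_order G P\<^esub> \<Delta> = ss ! i)"

text \<open>
  The normal form of \<open>g\<close> is unique, except that in the trivial group (\<open>\<Delta> = \<one>\<close>) the exponent \<open>r\<close> is
  arbitrary; the description below is over the resulting element, which is unique in all cases.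
\<close>

definition cycling :: "'a \<Rightarrow> 'a"
  where "cycling g = (THE h. \<exists>r ss. normal_form g r ss \<and>
    h = (case ss of [] \<Rightarrow> g | s # ss' \<Rightarrow> \<Delta> [^] r \<otimes> mprod G ss' \<otimes> tau_pow (- r) s))"

definition conj_class :: "'a \<Rightarrow> 'a set"
  where "conj_class g = {inv x \<otimes> g \<otimes> x | x. x \<in> carrier G}"

definition summit_inf :: "'a \<Rightarrow> int"
  where "summit_inf g = (GREATEST r. r \<in> inf_exp ` conj_class g)"

definition summit_sup :: "'a \<Rightarrow> int"
  where "summit_sup g = (LEAST s. s \<in> sup_exp ` conj_class g)"

definition super_summit_set :: "'a \<Rightarrow> 'a set"
  where "super_summit_set g =
    {h \<in> conj_class g. inf_exp h = summit_inf g \<and> sup_exp h = summit_sup g}"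

definition ultra_summit_set :: "'a \<Rightarrow> 'a set"
  where "ultra_summit_set g =
    {h \<in> super_summit_set g. \<exists>k\<ge>1. (cycling ^^ k) h = h}"

definition ultra_summit_element :: "'a \<Rightarrow> bool"
  where "ultra_summit_element h \<longleftrightarrow> h \<in> ultra_summit_set h"

end

end

theory Submission
  imports Defs "HOL-Analysis.Brouwer_Fixpoint"
begin

text \<open>
  Let \<open>\<Phi> x = h x \<Delta>\<^sup>-\<^sup>k\<close>, an automorphism of the lattice \<open>(G, \<le>\<^sub>L)\<close>. Then \<open>inf (x\<^sup>-\<^sup>1 h x) \<ge> k\<close> if and only if
  \<open>x \<le>\<^sub>L \<Phi> x\<close>, and with \<open>k = inf (x\<^sup>-\<^sup>1 h x)\<close> the element \<open>\<Phi> x \<and> x \<Delta>\<close> conjugates \<open>h\<close> to the cycling of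
  \<open>x\<^sup>-\<^sup>1 h x\<close>. So all moves that turn a conjugate of \<open>h\<close> into an ultra summit element are built from meets,
  right multiplication by powers of \<open>\<Delta>\<close> and left multiplication by \<open>h\<close>. The set of \<open>x\<close> for which
  \<open>x\<^sup>-\<^sup>1 f x\<close> is an ultra summit element is closed under these operations for every \<open>f\<close> commuting with
  \<open>h\<close>; hence one more element of \<open>H\<close> can always be made ultra summit without spoiling the others.

  To stop after finitely many moves one needs \<open>H\<close> to be finitely generated. Its rank is smaller than
  the number of simple elements, by a topological argument: from \<open>n\<close> independent elements one gets,
  by interpolating the orbit map \<open>\<int>\<^sup>n \<rightarrow> G\<close> with meets (in the manner of McShane's extension of Lipschitz
  functions) and mapping back equivariantly and affinely, a map of \<open>\<real>\<^sup>n\<close> at bounded distance from the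
  identity, hence surjective; but its values lie in a locally finite family of simplices spanned by
  chains in \<open>[x, x \<Delta>]\<close>. Kuhn's lemma replaces Brouwer's theorem, since \<open>n\<close> is not a type. Finite index of a free
  subgroup then follows from \<open>inf (h\<^sup>m) \<ge> m k \<Longrightarrow> max {inf (x\<^sup>-\<^sup>1 h x)} \<ge> k\<close>.
\<close>

section \<open>Kuhn's lemma and general position\<close>

text \<open>Coordinate \<open>i\<close> of a lattice point is labelled by the sign of
  \<open>\<phi> v i - p i\<close>. The hypotheses \<open>upper\<close> and \<open>lower\<close> are
  the boundary conditions of Kuhn's lemma. In the unit cube that it returns every coordinate takes
  both labels, so \<open>near\<close> bounds the error at the corner \<open>v q\<close> from both
  sides by \<open>K\<close>.\<close>

lemma kuhn_approximate_zero:
  fixes \<phi> :: "(nat \<Rightarrow> int) \<Rightarrow> nat \<Rightarrow> real" and p :: "nat \<Rightarrow> real" and B :: int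
  assumes B: "0 < B"
    and upper: "\<And>v i. \<forall>j<n. \<bar>v j\<bar> \<le> B \<Longrightarrow> i < n \<Longrightarrow> v i = B \<Longrightarrow> p i \<le> \<phi> v i"
    and lower: "\<And>v i. \<forall>j<n. \<bar>v j\<bar> \<le> B \<Longrightarrow> i < n \<Longrightarrow> v i = - B \<Longrightarrow> \<phi> v i < p i"
    and near: "\<And>v v' i. \<lbrakk>\<forall>j<n. \<bar>v j\<bar> \<le> B; \<forall>j<n. \<bar>v' j\<bar> \<le> B; \<forall>j<n. \<bar>v j - v' j\<bar> \<le> 1; i < n\<rbrakk>
      \<Longrightarrow> \<bar>\<phi> v i - \<phi> v' i\<bar> \<le> K"
  obtains v where "\<forall>j<n. \<bar>v j\<bar> \<le> B" "\<forall>i<n. \<bar>\<phi> v i - p i\<bar> \<le> K"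
proof -
  define N where "N = nat (2 * B)"
  have N: "int N = 2 * B" "0 < N" using B by (auto simp: N_def)
  define v where "v x = (\<lambda>i. int (x i) - B)" for x :: "nat \<Rightarrow> nat"
  define label where "label x i = (if \<phi> (v x) i < p i then 0 else 1 :: nat)" for x i
  have box: "\<forall>j<n. \<bar>v x j\<bar> \<le> B" if "\<forall>j<n. x j \<le> N" for x
  proof (intro allI impI)
    fix j assume "j < n"
    then have "int (x j) \<le> 2 * B" using that N(1) by (metis of_nat_le_iff)
    then show "\<bar>v x j\<bar> \<le> B" by (simp add: v_def)
  qed
  obtain q where q: "\<forall>i<n. q i < N"
    and rs: "\<forall>i<n. \<exists>r s. (\<forall>j<n. q j \<le> r j \<and> r j \<le> q j + 1) \<and> (\<forall>j<n. q j \<le> s j \<and> s j \<le> q j + 1)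
      \<and> label r i \<noteq> label s i"
  proof (rule kuhn_lemma[of N n label])
    show "\<forall>x. (\<forall>i<n. x i \<le> N) \<longrightarrow> (\<forall>i<n. x i = 0 \<longrightarrow> label x i = 0)"
      using lower box by (auto simp: label_def v_def)
    show "\<forall>x. (\<forall>i<n. x i \<le> N) \<longrightarrow> (\<forall>i<n. x i = N \<longrightarrow> label x i = 1)"
    proof (intro allI impI)
      fix x i assume x: "\<forall>i<n. x i \<le> N" "i < n" "x i = N"
      then have "v x i = B" using N by (simp add: v_def)
      with upper[OF box[OF x(1)] x(2)] show "label x i = 1" by (simp add: label_def)
    qed
  qed (use N in \<open>auto simp: label_def\<close>)
  have "\<bar>\<phi> (v q) i - p i\<bar> \<le> K" if i: "i < n" for i
  proof -
    obtain r s where r: "\<forall>j<n. q j \<le> r j \<and> r j \<le> q j + 1" and s: "\<forall>j<n. q j \<le> s j \<and> s j \<le> q j + 1"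
      and l: "label r i \<noteq> label s i"
      using rs i by blast
    have near': "\<bar>\<phi> (v q) i - \<phi> (v x) i\<bar> \<le> K" if x: "\<forall>j<n. q j \<le> x j \<and> x j \<le> q j + 1" for x
    proof (rule near[OF box box _ i])
      show "\<forall>j<n. q j \<le> N" using q by (simp add: less_imp_le)
      show "\<forall>j<n. x j \<le> N" using x q by (metis Suc_eq_plus1 Suc_leI le_trans)
      show "\<forall>j<n. \<bar>v q j - v x j\<bar> \<le> 1"
      proof (intro allI impI)
        fix j assume "j < n"
        then have "q j \<le> x j" "x j \<le> q j + 1" using x by auto
        then show "\<bar>v q j - v x j\<bar> \<le> 1" by (simp add: v_def)
      qed
    qed
    show ?thesis
      using near'[OF r] near'[OF s] l by (auto simp: label_def split: if_splits)
  qed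
  with that[of "v q"] box[of q] q show ?thesis by (simp add: less_imp_le)
qed

text \<open>Gaussian elimination, one equation at a time: the members of \<open>S\<close> are the
  equations, \<open>I\<close> indexes the unknowns.\<close>

lemma homogeneous_system_nontrivial:
  fixes S :: "('i \<Rightarrow> 'f :: field) set"
  assumes "finite S" "finite I" "card S < card I"
  shows "\<exists>a. (\<exists>i\<in>I. a i \<noteq> 0) \<and> (\<forall>y\<in>S. (\<Sum>i\<in>I. a i * y i) = 0)"
  using assms
proof (induction "card S" arbitrary: S I rule: less_induct)
  case less
  show ?case
  proof (cases "S = {}")
    case True
    then have "I \<noteq> {}" using less(4) by auto
    with True show ?thesis by (intro exI[of _ "\<lambda>_. 1"]) auto
  next
    case False
    then obtain y0 where y0: "y0 \<in> S" by blast
    define S' where "S' = S - {y0}"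
    have S': "Suc (card S') = card S" "finite S'" "S = insert y0 S'"
      using card_Suc_Diff1[OF less(2) y0] less(2) y0 by (auto simp: S'_def)
    show ?thesis
    proof (cases "\<forall>i\<in>I. y0 i = 0")
      case True
      obtain a where "\<exists>i\<in>I. a i \<noteq> 0" "\<forall>y\<in>S'. (\<Sum>i\<in>I. a i * y i) = 0"
        using less(1)[OF _ S'(2) less(3)] less(4) S'(1) by auto
      with True S' show ?thesis by (intro exI[of _ a]) auto
    next
      case False
      then obtain k where k: "k \<in> I" "y0 k \<noteq> 0" by blast
      \<comment> \<open>Subtracts the multiple of the pivot equation \<open>y0\<close> that clears
        the unknown \<open>k\<close>.\<close>
      define red where "red y = (\<lambda>i. y i - y k / y0 k * y0 i)" for y
      have fin: "finite (red ` S')" using S' by simp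
      have card: "card (red ` S') < card (I - {k})"
        using card_image_le[OF S'(2), of red] less(3,4) S'(1) k by simp
      have "card (red ` S') < card S"
        using card_image_le[OF S'(2), of red] S'(1) by simp
      from less(1)[OF this fin _ card] less(3) obtain a where a: "\<exists>i\<in>I - {k}. a i \<noteq> 0" "\<forall>y\<in>red ` S'. (\<Sum>i\<in>I - {k}. a i * y i) = 0"
        by blast
      \<comment> \<open>Back substitution: the value at \<open>k\<close> is chosen to satisfy
        \<open>y0\<close>; every other equation is a reduced one plus a multiple of
        \<open>y0\<close>.\<close>
      define b where "b = a(k := - (\<Sum>i\<in>I - {k}. a i * y0 i) / y0 k)"
      have split: "(\<Sum>i\<in>I. b i * y i) = (\<Sum>i\<in>I - {k}. a i * y i) - (\<Sum>i\<in>I - {k}. a i * y0 i) / y0 k * y k" for y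
      proof -
        have "(\<Sum>i\<in>I - {k}. b i * y i) = (\<Sum>i\<in>I - {k}. a i * y i)"
          by (intro sum.cong) (auto simp: b_def)
        then show ?thesis
          using sum.remove[OF less(3) k(1), of "\<lambda>i. b i * y i"] by (simp add: b_def)
      qed
      have "(\<Sum>i\<in>I. b i * y i) = 0" if "y \<in> S" for y
      proof (cases "y = y0")
        case True
        then show ?thesis using k by (simp add: split)
      next
        case False
        then have "y \<in> S'" using that by (simp add: S'_def)
        then have "(\<Sum>i\<in>I - {k}. a i * (y i - y k / y0 k * y0 i)) = 0" using a(2) by (simp add: red_def)
        then have "(\<Sum>i\<in>I - {k}. a i * y i) = y k / y0 k * (\<Sum>i\<in>I - {k}. a i * y0 i)"
          by (simp add: algebra_simps sum_subtractf sum_distrib_left)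
        then show ?thesis by (simp add: split)
      qed
      moreover have "\<exists>i\<in>I. b i \<noteq> 0" using a(1) by (auto simp: b_def)
      ultimately show ?thesis by blast
    qed
  qed
qed

text \<open>At most \<open>n\<close> points of R^n share an affine equation, and restricting it to
  the moment curve (t, t^2, ..., t^n) gives a nonzero polynomial in t. Finitely many such
  polynomials have finitely many roots, so one \<open>t\<close> avoids them all;
  \<open>\<delta>\<close> records the margin relative to the l1 norm of the normal vector.\<close>

lemma generic_moment_point:
  fixes V :: "(nat \<Rightarrow> real) set"
  assumes V: "finite V"
  obtains t \<delta> :: real where "0 < t" "t < 1" "0 < \<delta>"
    "\<And>S. S \<subseteq> V \<Longrightarrow> card S \<le> n \<Longrightarrow> \<exists>a b. (\<forall>y\<in>S. (\<Sum>i<n. a i * y i) = b) \<and>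
      \<delta> * (\<Sum>i<n. \<bar>a i\<bar>) < \<bar>(\<Sum>i<n. a i * t ^ Suc i) - b\<bar>"
proof -
  define \<S> where "\<S> = {S. S \<subseteq> V \<and> card S \<le> n}"
  have fin: "finite \<S>" using V by (simp add: \<S>_def)
  have "\<exists>c. (\<exists>i\<le>n. c i \<noteq> 0) \<and> (\<forall>y\<in>S. (\<Sum>i<n. c (Suc i) * y i) = c 0)" if "S \<in> \<S>" for S
  proof -
    \<comment> \<open>The extra coordinate -1 makes the affine equation homogeneous, with
      \<open>c 0\<close> as its constant term.\<close>
    define lift where "lift y = (\<lambda>i. if i = 0 then - 1 else y (i - 1))" for y :: "nat \<Rightarrow> real"
    have "finite S" "card S \<le> n" using that V finite_subset by (auto simp: \<S>_def)
    then have "finite (lift ` S)" "card (lift ` S) < card {..n}"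
      using card_image_le[of S lift] by auto
    then obtain c where c: "\<exists>i\<in>{..n}. c i \<noteq> 0" "\<forall>y\<in>lift ` S. (\<Sum>i\<in>{..n}. c i * y i) = 0"
      using homogeneous_system_nontrivial[of "lift ` S" "{..n}"] by auto
    have "(\<Sum>i<n. c (Suc i) * y i) = c 0" if "y \<in> S" for y
    proof -
      have "(\<Sum>i\<le>n. c i * lift y i) = 0" using c(2) that by blast
      then show ?thesis by (simp add: sum.atMost_shift lift_def)
    qed
    with c(1) show ?thesis by (intro exI[of _ c]) auto
  qed
  then obtain c where c: "\<And>S. S \<in> \<S> \<Longrightarrow> \<exists>i\<le>n. c S i \<noteq> 0"
    "\<And>S y. S \<in> \<S> \<Longrightarrow> y \<in> S \<Longrightarrow> (\<Sum>i<n. c S (Suc i) * y i) = c S 0" by metis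
  define neg where "neg S = (\<lambda>i. if i = 0 then - c S 0 else c S i)" for S
  have "finite {x. (\<Sum>i\<le>n. neg S i * x ^ i) = 0}" if S: "S \<in> \<S>" for S
  proof -
    obtain i where "i \<le> n" "c S i \<noteq> 0" using c(1)[OF S] by blast
    then have "neg S i \<noteq> 0" by (cases "i = 0") (auto simp: neg_def)
    then show ?thesis using \<open>i \<le> n\<close> polyfun_finite_roots[of "neg S" n] by blast
  qed
  then have "finite (\<Union>S\<in>\<S>. {x. (\<Sum>i\<le>n. neg S i * x ^ i) = 0})" using fin by blast
  then have "infinite ({0<..<1} - (\<Union>S\<in>\<S>. {x. (\<Sum>i\<le>n. neg S i * x ^ i) = 0}))"
    using infinite_Ioo[of 0 "1 :: real"] by (simp add: Diff_infinite_finite)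
  then have "{0<..<1} - (\<Union>S\<in>\<S>. {x. (\<Sum>i\<le>n. neg S i * x ^ i) = 0}) \<noteq> {}"
    by (rule infinite_imp_nonempty)
  then obtain t where t': "t \<in> {0<..<1} - (\<Union>S\<in>\<S>. {x. (\<Sum>i\<le>n. neg S i * x ^ i) = 0})"
    by blast
  then have t: "0 < t" "t < 1" by auto
  have t_root: "(\<Sum>i\<le>n. neg S i * t ^ i) \<noteq> 0" if "S \<in> \<S>" for S
    using t' that by blast
  define dist where "dist S = \<bar>(\<Sum>i<n. c S (Suc i) * t ^ Suc i) - c S 0\<bar>" for S
  define size where "size S = (\<Sum>i<n. \<bar>c S (Suc i)\<bar>)" for S
  have dist: "0 < dist S" if "S \<in> \<S>" for S
    using t_root[OF that] by (simp add: dist_def neg_def sum.atMost_shift)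
  have size: "0 \<le> size S" for S by (simp add: size_def sum_nonneg)
  \<comment> \<open>The denominator \<open>size S + 1\<close> is positive even for a zero normal
    vector, and it makes the final inequality strict.\<close>
  define \<delta> where "\<delta> = Min (insert 1 ((\<lambda>S. dist S / (size S + 1)) ` \<S>))"
  have \<delta>: "0 < \<delta>" unfolding \<delta>_def using fin dist size by (subst Min_gr_iff) (auto intro!: divide_pos_pos add_nonneg_pos)
  have dominated: "\<delta> * size S < dist S" if "S \<in> \<S>" for S
  proof -
    have "\<delta> \<le> dist S / (size S + 1)" unfolding \<delta>_def using fin that by (intro Min_le) auto
    then have "\<delta> * (size S + 1) \<le> dist S"
      using size[of S] by (simp add: pos_le_divide_eq add_nonneg_pos)
    then show ?thesis using \<delta> by (simp add: algebra_simps)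
  qed
  show ?thesis
  proof (rule that[OF t \<delta>])
    fix S assume "S \<subseteq> V" "card S \<le> n"
    then have S: "S \<in> \<S>" by (simp add: \<S>_def)
    from dominated[OF S] c(2)[OF S]
    show "\<exists>a b. (\<forall>y\<in>S. (\<Sum>i<n. a i * y i) = b) \<and>
        \<delta> * (\<Sum>i<n. \<bar>a i\<bar>) < \<bar>(\<Sum>i<n. a i * t ^ Suc i) - b\<bar>"
      unfolding dist_def size_def by (intro exI[of _ "\<lambda>i. c S (Suc i)"] exI[of _ "c S 0"]) simp
  qed
qed

text \<open>By convexity every value of \<open>s\<close> is left at most once, so there are at most
  as many jumps as values. If \<open>s (j - c)\<close> and \<open>s (j + c)\<close> differ, a jump
  occurs between them, and each jump accounts for only \<open>2 * c\<close> indices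
  \<open>j\<close>.\<close>

lemma card_variation_window:
  fixes s :: "int \<Rightarrow> 'b" and c q :: int
  assumes convex: "\<And>i j k. i \<le> j \<Longrightarrow> j \<le> k \<Longrightarrow> s i = s k \<Longrightarrow> s i = s j"
    and fin: "finite (s ` {- c..<q + c})" and c: "0 \<le> c"
  shows "card {j \<in> {0..<q}. s (j - c) \<noteq> s (j + c)} \<le> card (s ` {- c..<q + c}) * nat (2 * c)"
proof -
  define J where "J = {i \<in> {- c..<q + c}. s i \<noteq> s (i + 1)}"
  have "inj_on s J"
  proof (rule linorder_inj_onI)
    fix i i' assume "i < i'" "i \<in> J" "i' \<in> J"
    then show "s i \<noteq> s i'" using convex[of i "i + 1" i'] by (auto simp: J_def)
  qed auto
  then have "card J = card (s ` J)" by (simp add: card_image)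
  also have "\<dots> \<le> card (s ` {- c..<q + c})"
    using fin by (intro card_mono) (auto simp: J_def)
  finally have J: "card J \<le> card (s ` {- c..<q + c})" .
  have "finite J" by (rule finite_subset[of _ "{- c..<q + c}"]) (auto simp: J_def)
  have const: "s (i + int k) = s i" if "\<forall>m\<in>{i..<i + int k}. s m = s (m + 1)" for i k
    using that
  proof (induction k)
    case (Suc k)
    then have "s (i + int k) = s i" "s (i + int k) = s (i + int k + 1)" by auto
    then show ?case by (simp add: algebra_simps)
  qed simp
  have "{j \<in> {0..<q}. s (j - c) \<noteq> s (j + c)} \<subseteq> (\<Union>i\<in>J. {i - c<..i + c})"
  proof
    fix j assume j: "j \<in> {j \<in> {0..<q}. s (j - c) \<noteq> s (j + c)}"
    have "\<exists>m\<in>{j - c..<j + c}. s m \<noteq> s (m + 1)"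
    proof (rule ccontr)
      assume no: "\<not> ?thesis"
      have end_eq: "j - c + int (nat (2 * c)) = j + c" using c by simp
      have "s (j + c) = s (j - c)"
        using no by (intro const[of "j - c" "nat (2 * c)", unfolded end_eq]) blast
      with j show False by simp
    qed
    then obtain m where "m \<in> {j - c..<j + c}" "s m \<noteq> s (m + 1)" by blast
    then show "j \<in> (\<Union>i\<in>J. {i - c<..i + c})" using j by (intro UN_I[of m]) (auto simp: J_def)
  qed
  then have "card {j \<in> {0..<q}. s (j - c) \<noteq> s (j + c)} \<le> card (\<Union>i\<in>J. {i - c<..i + c})"
    using \<open>finite J\<close> by (intro card_mono) auto
  also have "\<dots> \<le> (\<Sum>i\<in>J. card {i - c<..i + c})" using \<open>finite J\<close> by (rule card_UN_le)
  also have "\<dots> = card J * nat (2 * c)" by simp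
  also have "\<dots> \<le> card (s ` {- c..<q + c}) * nat (2 * c)" using J by simp
  finally show ?thesis .
qed

section \<open>Left divisibility in a Garside group\<close>

context garside_group
begin

abbreviation dvd_left (infix "\<preceq>" 50)
  where "a \<preceq> b \<equiv> le_left G P a b"

abbreviation gcd_left (infixl "\<triangle>" 65)
  where "x \<triangle> y \<equiv> x \<sqinter>\<^bsub>left_order G P\<^esub> y"

abbreviation D :: "int \<Rightarrow> 'a"
  where "D r \<equiv> \<Delta> [^] r"

lemma P_subset: "P \<subseteq> carrier G"
  and one_P [simp, intro]: "\<one> \<in> P"
  and mult_P [simp, intro]: "a \<in> P \<Longrightarrow> b \<in> P \<Longrightarrow> a \<otimes> b \<in> P"
  using submonoid by (auto simp: submonoid.subset submonoid.one_closed submonoid.m_closed)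

lemma P_carrier [simp, intro]: "a \<in> P \<Longrightarrow> a \<in> carrier G"
  using P_subset by blast

lemma Delta_P [simp, intro]: "\<Delta> \<in> P"
  using garside_monoid.Delta_closed[OF garside] by simp

lemma Delta_closed [simp, intro]: "\<Delta> \<in> carrier G"
  by blast

lemma inv_cancel_left [simp]:
  assumes "a \<in> carrier G" "b \<in> carrier G"
  shows "inv a \<otimes> (a \<otimes> b) = b" "a \<otimes> (inv a \<otimes> b) = b"
  using assms by (simp_all flip: m_assoc)

lemma D_mult [simp]: "D r \<otimes> D s = D (r + s)"
  by (simp add: int_pow_mult)

lemma D_mult_assoc [simp]: "b \<in> carrier G \<Longrightarrow> D r \<otimes> (D s \<otimes> b) = D (r + s) \<otimes> b"
  by (simp flip: m_assoc)

lemma inv_D [simp]: "inv (D r) = D (- r)"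
  by (simp add: int_pow_neg)

lemma D_1: "D 1 = \<Delta>"
  by (simp add: int_pow_1)

declare int_pow_1 [simp del]

lemma le_iff: "a \<in> carrier G \<Longrightarrow> b \<in> carrier G \<Longrightarrow> a \<preceq> b \<longleftrightarrow> inv a \<otimes> b \<in> P"
  unfolding le_left_def by (metis P_carrier inv_cancel_left)

lemma le_refl [simp]: "a \<in> carrier G \<Longrightarrow> a \<preceq> a"
  by (simp add: le_iff)

lemma le_trans [trans]:
  assumes "a \<preceq> b" "b \<preceq> c" "a \<in> carrier G"
  shows "a \<preceq> c"
  using assms unfolding le_left_def by (metis P_carrier m_assoc mult_P)

lemma le_mult_left_iff [simp]:
  "x \<in> carrier G \<Longrightarrow> a \<in> carrier G \<Longrightarrow> b \<in> carrier G \<Longrightarrow> x \<otimes> a \<preceq> x \<otimes> b \<longleftrightarrow> a \<preceq> b"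
  by (simp add: le_iff m_assoc inv_mult_group)

lemma one_le_iff: "a \<in> carrier G \<Longrightarrow> \<one> \<preceq> a \<longleftrightarrow> a \<in> P"
  by (simp add: le_iff)

lemma P_partial_order: "partial_order (left_order (G\<lparr>carrier := P\<rparr>) P)"
  using garside_monoid.lattice_left[OF garside]
  by (simp add: Lattice.lattice_def upper_semilattice_def)

lemma P_units:
  assumes "a \<in> P" "inv a \<in> P"
  shows "a = \<one>"
proof -
  interpret partial_order "left_order (G\<lparr>carrier := P\<rparr>) P"
    by (rule P_partial_order)
  have "le_left (G\<lparr>carrier := P\<rparr>) P \<one> a" "le_left (G\<lparr>carrier := P\<rparr>) P a \<one>"
    using assms unfolding le_left_def by (auto intro: bexI[of _ a] bexI[of _ "inv a"])
  with le_antisym[of \<one> a] assms show ?thesis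
    by (simp add: left_order_def)
qed

lemma le_antisym:
  assumes "a \<preceq> b" "b \<preceq> a" "a \<in> carrier G" "b \<in> carrier G"
  shows "a = b"
proof -
  have "inv a \<otimes> b \<in> P" "inv (inv a \<otimes> b) \<in> P"
    using assms by (auto simp: le_iff inv_mult_group)
  then have "inv a \<otimes> b = \<one>"
    by (rule P_units)
  then show ?thesis
    using assms by (metis inv_cancel_left(2) r_one)
qed

lemma simples_iff: "a \<in> simples \<longleftrightarrow> a \<in> P \<and> a \<preceq> \<Delta>"
  by (simp only: simples_def mem_Collect_eq)

lemma simples_P [simp, intro]: "a \<in> simples \<Longrightarrow> a \<in> P"
  unfolding simples_def by blast

lemma Delta_balanced: "a \<in> P \<Longrightarrow> a \<preceq> \<Delta> \<longleftrightarrow> le_right G P a \<Delta>"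
  using garside_monoid.Delta_balanced[OF garside, of a] by (simp add: le_left_def le_right_def)

lemma simple_complements:
  assumes "a \<in> simples"
  shows "inv a \<otimes> \<Delta> \<in> simples" and "\<Delta> \<otimes> inv a \<in> simples"
proof -
  have a: "a \<in> P" "a \<preceq> \<Delta>" using assms unfolding simples_def by blast+
  then have c: "inv a \<otimes> \<Delta> \<in> P" by (simp add: le_iff)
  have "le_right G P (inv a \<otimes> \<Delta>) \<Delta>"
    using a unfolding le_right_def by (intro bexI[of _ a]) auto
  then show "inv a \<otimes> \<Delta> \<in> simples"
    using c unfolding simples_def by (blast intro: Delta_balanced[THEN iffD2])
  obtain d where d: "d \<in> P" "d \<otimes> a = \<Delta>"
    using a by (auto simp: Delta_balanced le_right_def)
  then have "d = \<Delta> \<otimes> inv a"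
    using a by (simp add: inv_solve_right)
  moreover have "d \<preceq> \<Delta>" using d a by (auto simp: le_left_def)
  ultimately show "\<Delta> \<otimes> inv a \<in> simples"
    using d(1) by (simp only: simples_iff)
qed

text \<open>Taking the complement in \<Delta> twice on the same side is conjugation by
  \<Delta>.\<close>

lemma conj_Delta_simples:
  assumes "a \<in> simples"
  shows "inv \<Delta> \<otimes> a \<otimes> \<Delta> \<in> simples" and "\<Delta> \<otimes> a \<otimes> inv \<Delta> \<in> simples"
  using simple_complements(1)[OF simple_complements(1)[OF assms]]
    simple_complements(2)[OF simple_complements(2)[OF assms]] assms
  by (simp_all add: inv_mult_group m_assoc)

lemma P_induct [consumes 1, case_names one mult]:
  assumes p: "p \<in> P"
    and 1: "Q \<one>"
    and step: "\<And>s p. s \<in> simples \<Longrightarrow> p \<in> P \<Longrightarrow> Q p \<Longrightarrow> Q (s \<otimes> p)"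
  shows "Q p"
proof -
  obtain as where as: "set as \<subseteq> simples" "mprod G as = p"
    using garside_monoid.Delta_generates[OF garside] p
    unfolding monoid_generated_by_def mprod_def simples_def le_left_def by auto
  from as(1) have "mprod G as \<in> P \<and> Q (mprod G as)"
    by (induction as) (auto simp: mprod_def 1 intro!: step)
  with as show ?thesis by simp
qed

lemma conj_Delta_P:
  assumes "p \<in> P"
  shows "inv \<Delta> \<otimes> p \<otimes> \<Delta> \<in> P" and "\<Delta> \<otimes> p \<otimes> inv \<Delta> \<in> P"
proof -
  show "inv \<Delta> \<otimes> p \<otimes> \<Delta> \<in> P"
    using assms
  proof (induction rule: P_induct)
    case (mult s p)
    have "inv \<Delta> \<otimes> (s \<otimes> p) \<otimes> \<Delta> = (inv \<Delta> \<otimes> s \<otimes> \<Delta>) \<otimes> (inv \<Delta> \<otimes> p \<otimes> \<Delta>)"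
      using mult by (simp add: m_assoc)
    with mult conj_Delta_simples show ?case by simp
  qed auto
  show "\<Delta> \<otimes> p \<otimes> inv \<Delta> \<in> P"
    using assms
  proof (induction rule: P_induct)
    case (mult s p)
    have "\<Delta> \<otimes> (s \<otimes> p) \<otimes> inv \<Delta> = (\<Delta> \<otimes> s \<otimes> inv \<Delta>) \<otimes> (\<Delta> \<otimes> p \<otimes> inv \<Delta>)"
      using mult by (simp add: m_assoc)
    with mult conj_Delta_simples show ?case by simp
  qed auto
qed

lemma inv_Delta: "inv \<Delta> = D (- 1)"
  by (simp add: int_pow_neg D_1)

lemma conj_D_P:
  assumes "p \<in> P"
  shows "D (- r) \<otimes> p \<otimes> D r \<in> P"
proof (induction r rule: int_induct[where k = 0])
  case base
  then show ?case using assms by simp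
next
  case (step1 i)
  have "D (- (i + 1)) \<otimes> p \<otimes> D (i + 1) = D (- 1) \<otimes> (D (- i) \<otimes> p \<otimes> D i) \<otimes> D 1"
    using assms by (simp add: m_assoc algebra_simps)
  then have "D (- (i + 1)) \<otimes> p \<otimes> D (i + 1) = inv \<Delta> \<otimes> (D (- i) \<otimes> p \<otimes> D i) \<otimes> \<Delta>"
    by (simp add: inv_Delta D_1)
  with conj_Delta_P(1)[OF step1(2)] show ?case by simp
next
  case (step2 i)
  have "D (- (i - 1)) \<otimes> p \<otimes> D (i - 1) = D 1 \<otimes> (D (- i) \<otimes> p \<otimes> D i) \<otimes> D (- 1)"
    using assms by (simp add: m_assoc algebra_simps)
  then have "D (- (i - 1)) \<otimes> p \<otimes> D (i - 1) = \<Delta> \<otimes> (D (- i) \<otimes> p \<otimes> D i) \<otimes> inv \<Delta>"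
    by (simp add: inv_Delta D_1)
  with conj_Delta_P(2)[OF step2(2)] show ?case by simp
qed

lemma conj_D_P_iff:
  assumes "g \<in> carrier G"
  shows "D (- r) \<otimes> g \<otimes> D r \<in> P \<longleftrightarrow> g \<in> P"
proof
  assume "D (- r) \<otimes> g \<otimes> D r \<in> P"
  from conj_D_P[OF this, of "- r"] show "g \<in> P"
    using assms by (simp add: m_assoc)
qed (rule conj_D_P)

text \<open>Left divisibility is invariant under all left multiplications, but under these right
  multiplications only because conjugation by \<Delta> maps \<open>P\<close> onto itself.\<close>

lemma le_mult_D_iff [simp]:
  assumes "a \<in> carrier G" "b \<in> carrier G"
  shows "a \<otimes> D r \<preceq> b \<otimes> D r \<longleftrightarrow> a \<preceq> b"
  using assms conj_D_P_iff[of "inv a \<otimes> b" r]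
  by (simp add: le_iff m_assoc inv_mult_group)

section \<open>Bounds by powers of \<Delta>\<close>

lemma D_P: "0 \<le> r \<Longrightarrow> D r \<in> P"
  by (induction r rule: int_ge_induct) (auto simp: D_1 simp flip: D_mult)

lemma le_mult_P: "a \<in> carrier G \<Longrightarrow> p \<in> P \<Longrightarrow> a \<preceq> a \<otimes> p"
  by (auto simp: le_left_def)

lemma D_mono: "r \<le> s \<Longrightarrow> D r \<preceq> D s"
  using le_mult_P[of "D r" "D (s - r)"] D_P[of "s - r"] by simp

lemma mult_D_mono: "a \<in> carrier G \<Longrightarrow> r \<le> s \<Longrightarrow> a \<otimes> D r \<preceq> a \<otimes> D s"
  by (simp add: D_mono)

lemma mult_le_D:
  assumes "g \<preceq> D r" "h \<preceq> D s" "g \<in> carrier G" "h \<in> carrier G"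
  shows "g \<otimes> h \<preceq> D (r + s)"
proof -
  have "g \<otimes> h \<preceq> g \<otimes> D s" using assms by simp
  also have "g \<otimes> D s \<preceq> D r \<otimes> D s" using assms by (simp del: D_mult)
  finally show ?thesis using assms by simp
qed

lemma D_le_mult:
  assumes "D r \<preceq> g" "D s \<preceq> h" "g \<in> carrier G" "h \<in> carrier G"
  shows "D (r + s) \<preceq> g \<otimes> h"
proof -
  have "D (r + s) \<preceq> g \<otimes> D s" using assms le_mult_D_iff[of "D r" g s] by simp
  also have "g \<otimes> D s \<preceq> g \<otimes> h" using assms by simp
  finally show ?thesis using assms by simp
qed

lemma le_D_iff_inv:
  assumes "g \<in> carrier G"
  shows "g \<preceq> D s \<longleftrightarrow> D (- s) \<preceq> inv g"
  using assms conj_D_P_iff[of "D s \<otimes> inv g" s]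
  by (simp add: le_iff m_assoc)

lemma P_le_D:
  assumes "p \<in> P"
  shows "\<exists>k\<ge>0. p \<preceq> D k"
  using assms
proof (induction rule: P_induct)
  case one
  then show ?case by (auto intro!: exI[of _ 0])
next
  case (mult s p)
  then obtain k where k: "k \<ge> 0" "p \<preceq> D k" by blast
  have "s \<preceq> D 1" using mult unfolding simples_def by (simp add: D_1)
  then have "s \<otimes> p \<preceq> D (1 + k)"
    using mult k by (intro mult_le_D) auto
  with k show ?case by (intro exI[of _ "1 + k"]) auto
qed

lemma bounded_D:
  assumes "g \<in> carrier G"
  obtains k where "k \<ge> 0" "D (- k) \<preceq> g" "g \<preceq> D k"
proof -
  obtain a b where ab: "a \<in> P" "b \<in> P" "g = inv a \<otimes> b"
    using fractions[OF assms] by blast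
  obtain k l where kl: "k \<ge> 0" "l \<ge> 0" "a \<preceq> D k" "b \<preceq> D l"
    using P_le_D ab by meson
  have "D (- k) \<preceq> inv a" using kl ab by (simp add: le_D_iff_inv)
  then have "D (- k + 0) \<preceq> g"
    unfolding ab(3) using ab by (intro D_le_mult) (auto simp: one_le_iff)
  moreover have "inv a \<preceq> D 0" using ab by (simp add: le_iff)
  then have "g \<preceq> D (0 + l)"
    unfolding ab(3) using ab kl by (intro mult_le_D) auto
  ultimately have "D (- (k + l)) \<preceq> g" "g \<preceq> D (k + l)"
    using kl D_mono[of "- (k + l)" "- k"] D_mono[of l "k + l"] assms
    by (auto elim: le_trans)
  with kl that[of "k + l"] show ?thesis by simp
qed

lemma bounded_D_finite:
  assumes "finite A" "A \<subseteq> carrier G"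
  obtains k where "k \<ge> 0" "\<And>g. g \<in> A \<Longrightarrow> D (- k) \<preceq> g \<and> g \<preceq> D k"
proof -
  have "\<exists>k\<ge>0. \<forall>g\<in>A. D (- k) \<preceq> g \<and> g \<preceq> D k"
    using assms
  proof (induction A)
    case empty
    then show ?case by auto
  next
    case (insert g A)
    then obtain k where k: "k \<ge> 0" "\<forall>g\<in>A. D (- k) \<preceq> g \<and> g \<preceq> D k" by auto
    obtain l where l: "l \<ge> 0" "D (- l) \<preceq> g" "g \<preceq> D l"
      using bounded_D insert by (metis insert_subset)
    have "D (- (k + l)) \<preceq> h \<and> h \<preceq> D (k + l)" if "h \<in> insert g A" for h
    proof -
      define j where "j = (if h = g then l else k)"
      have j: "0 \<le> j" "j \<le> k + l" "D (- j) \<preceq> h" "h \<preceq> D j"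
        using that k l by (auto simp: j_def)
      have "h \<in> carrier G" using that insert by auto
      with j show ?thesis
        using le_trans[OF D_mono[of "- (k + l)" "- j"] j(3)] le_trans[OF j(4) D_mono[of j "k + l"]]
        by simp
    qed
    with k l show ?case by (intro exI[of _ "k + l"]) auto
  qed
  with that show ?thesis by blast
qed

section \<open>Meets in the group\<close>

lemma P_glb_exists:
  assumes "x \<in> P" "y \<in> P"
  obtains l where "l \<in> P" "l \<preceq> x" "l \<preceq> y" "\<And>z. z \<in> P \<Longrightarrow> z \<preceq> x \<Longrightarrow> z \<preceq> y \<Longrightarrow> z \<preceq> l"
proof -
  interpret Lattice.lattice "left_order (G\<lparr>carrier := P\<rparr>) P"
    using garside_monoid.lattice_left[OF garside] by simp
  show ?thesis
    using inf_of_two_exists[of x y] that assms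
    by (auto simp: left_order_def le_left_def greatest_def Lower_def)
qed

text \<open>Shift both elements into \<open>P\<close> by \<open>D k\<close>, take the meet there and
  shift back. A common lower bound \<open>z\<close> need not be shifted into \<open>P\<close> by the
  same power, so a larger shift \<open>m\<close> is compared with it: \<open>D (m - k)\<close> is
  itself a common divisor after that shift, hence divides the larger meet, and cancelling it returns
  to the first meet.\<close>

lemma glb_exists:
  assumes "x \<in> carrier G" "y \<in> carrier G"
  obtains l where "l \<in> carrier G" "l \<preceq> x" "l \<preceq> y"
    "\<And>z. z \<in> carrier G \<Longrightarrow> z \<preceq> x \<Longrightarrow> z \<preceq> y \<Longrightarrow> z \<preceq> l"
proof -
  obtain k where k: "D (- k) \<preceq> x" "D (- k) \<preceq> y"
    using bounded_D_finite[of "{x, y}"] assms by (metis empty_subsetI finite.simps insertCI insert_subset)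
  then have P: "D k \<otimes> x \<in> P" "D k \<otimes> y \<in> P"
    using assms by (auto simp: le_iff)
  obtain l where l: "l \<in> P" "l \<preceq> D k \<otimes> x" "l \<preceq> D k \<otimes> y"
    "\<And>z. z \<in> P \<Longrightarrow> z \<preceq> D k \<otimes> x \<Longrightarrow> z \<preceq> D k \<otimes> y \<Longrightarrow> z \<preceq> l"
    using P_glb_exists[OF P] by blast
  have shift: "D (- j) \<otimes> a \<preceq> b \<longleftrightarrow> a \<preceq> D j \<otimes> b" if "a \<in> carrier G" "b \<in> carrier G" for a b j
    using that by (simp add: le_iff inv_mult_group m_assoc)
  have "z \<preceq> D (- k) \<otimes> l" if z: "z \<in> carrier G" "z \<preceq> x" "z \<preceq> y" for z
  proof -
    obtain m' where m': "m' \<ge> 0" "D (- m') \<preceq> z"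
      using bounded_D z by metis
    define m where "m = m' + \<bar>k\<bar>"
    have "D (- m) \<preceq> z"
      using D_mono[of "- m" "- m'"] m' unfolding m_def by (auto elim: le_trans)
    then have zP: "D m \<otimes> z \<in> P" using z by (simp add: le_iff)
    have mk: "m - k \<ge> 0" using m' by (simp add: m_def)
    have "D m \<otimes> z \<preceq> D m \<otimes> x" "D m \<otimes> z \<preceq> D m \<otimes> y" using z assms by auto
    moreover have eq: "D m \<otimes> x = D (m - k) \<otimes> (D k \<otimes> x)" "D m \<otimes> y = D (m - k) \<otimes> (D k \<otimes> y)"
      using assms by auto
    moreover have "D m \<otimes> x \<in> P" "D m \<otimes> y \<in> P" unfolding eq using mk P D_P by blast+
    then obtain n where n: "n \<in> P" "n \<preceq> D m \<otimes> x" "n \<preceq> D m \<otimes> y"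
      "\<And>z. z \<in> P \<Longrightarrow> z \<preceq> D m \<otimes> x \<Longrightarrow> z \<preceq> D m \<otimes> y \<Longrightarrow> z \<preceq> n"
      using P_glb_exists by blast
    have "D (m - k) \<preceq> n"
      using n(4)[of "D (m - k)"] D_P[OF mk] le_mult_P[of "D (m - k)"] P unfolding eq by simp
    then have d: "D (k - m) \<otimes> n \<in> P" using n(1) by (simp add: le_iff)
    have "D (k - m) \<otimes> n \<preceq> l"
      using n(1-3) l(4)[OF d] assms shift[of n _ "m - k"] by simp
    then have "n \<preceq> D (m - k) \<otimes> l" using shift[of n l "m - k"] n l by simp
    moreover have "D m \<otimes> z \<preceq> n" using n zP z assms by simp
    ultimately have "D m \<otimes> z \<preceq> D (m - k) \<otimes> l" using le_trans z by blast
    then have "D (- m) \<otimes> (D m \<otimes> z) \<preceq> D (- m) \<otimes> (D (m - k) \<otimes> l)"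
      using z l by (simp only: le_mult_left_iff int_pow_closed Delta_closed m_closed P_carrier)
    then show ?thesis using z l by simp
  qed
  then show ?thesis
    using that[of "D (- k) \<otimes> l"] l shift[of l _ k] assms by simp
qed

lemma lower_semilattice_left: "lower_semilattice (left_order G P)"
proof unfold_locales
  fix x y
  assume "x \<in> carrier (left_order G P)" "y \<in> carrier (left_order G P)"
  then have "x \<in> carrier G" "y \<in> carrier G" by (auto simp: left_order_def)
  from glb_exists[OF this] obtain l where "l \<in> carrier G" "l \<preceq> x" "l \<preceq> y"
    "\<And>z. z \<in> carrier G \<Longrightarrow> z \<preceq> x \<Longrightarrow> z \<preceq> y \<Longrightarrow> z \<preceq> l" by blast
  then show "\<exists>s. greatest (left_order G P) s (Lower (left_order G P) {x, y})"
    using \<open>x \<in> carrier G\<close> \<open>y \<in> carrier G\<close>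
    by (intro exI[of _ l]) (auto simp: greatest_def Lower_def left_order_def)
qed (auto simp: left_order_def dest: le_trans le_antisym)

lemma
  assumes "x \<in> carrier G" "y \<in> carrier G"
  shows meet_closed [simp, intro]: "x \<triangle> y \<in> carrier G"
    and meet_le1 [simp]: "x \<triangle> y \<preceq> x"
    and meet_le2 [simp]: "x \<triangle> y \<preceq> y"
proof -
  interpret lower_semilattice "left_order G P" by (rule lower_semilattice_left)
  show "x \<triangle> y \<in> carrier G" "x \<triangle> y \<preceq> x" "x \<triangle> y \<preceq> y"
    using meet_closed[of x y] meet_left[of x y] meet_right[of x y] assms
    by (auto simp: left_order_def)
qed

lemma meet_greatest:
  assumes "z \<preceq> x" "z \<preceq> y" "x \<in> carrier G" "y \<in> carrier G" "z \<in> carrier G"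
  shows "z \<preceq> x \<triangle> y"
proof -
  interpret lower_semilattice "left_order G P" by (rule lower_semilattice_left)
  show ?thesis
    using meet_le[of z x y] assms by (auto simp: left_order_def)
qed

lemma le_meet_iff:
  assumes "x \<in> carrier G" "y \<in> carrier G" "z \<in> carrier G"
  shows "z \<preceq> x \<triangle> y \<longleftrightarrow> z \<preceq> x \<and> z \<preceq> y"
  using le_trans[OF _ meet_le1[OF assms(1,2)] assms(3)] le_trans[OF _ meet_le2[OF assms(1,2)] assms(3)]
    meet_greatest[OF _ _ assms] by blast

lemma meet_eqI:
  assumes "x \<in> carrier G" "y \<in> carrier G" "l \<in> carrier G"
    and "\<And>z. z \<in> carrier G \<Longrightarrow> z \<preceq> l \<longleftrightarrow> z \<preceq> x \<and> z \<preceq> y"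
  shows "x \<triangle> y = l"
  using assms(1-3) assms(4)[of l] assms(4)[of "x \<triangle> y"] by (intro le_antisym) (auto simp: le_meet_iff)

lemma le_mult_left_swap:
  assumes "a \<in> carrier G" "b \<in> carrier G" "x \<in> carrier G"
  shows "a \<preceq> x \<otimes> b \<longleftrightarrow> inv x \<otimes> a \<preceq> b"
  using assms by (simp add: le_iff inv_mult_group m_assoc)

lemma le_mult_D_swap:
  assumes "a \<in> carrier G" "b \<in> carrier G"
  shows "a \<preceq> b \<otimes> D r \<longleftrightarrow> a \<otimes> D (- r) \<preceq> b"
  using assms le_mult_D_iff[of "a \<otimes> D (- r)" b r] by (simp add: m_assoc)

lemma meet_mult_left:
  assumes "x \<in> carrier G" "y \<in> carrier G" "a \<in> carrier G"
  shows "a \<otimes> (x \<triangle> y) = (a \<otimes> x) \<triangle> (a \<otimes> y)"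
  using assms
  by (intro meet_eqI[symmetric]) (auto simp: le_mult_left_swap le_meet_iff)

lemma meet_mult_D:
  assumes "x \<in> carrier G" "y \<in> carrier G"
  shows "(x \<triangle> y) \<otimes> D r = (x \<otimes> D r) \<triangle> (y \<otimes> D r)"
  using assms
  by (intro meet_eqI[symmetric]) (auto simp: le_mult_D_swap le_meet_iff)

lemma meet_mono:
  assumes "x \<preceq> x'" "y \<preceq> y'" "x \<in> carrier G" "y \<in> carrier G" "x' \<in> carrier G" "y' \<in> carrier G"
  shows "x \<triangle> y \<preceq> x' \<triangle> y'"
  using assms le_trans[OF meet_le1 assms(1)] le_trans[OF meet_le2 assms(2)]
  by (simp add: le_meet_iff)

end

section \<open>Infimum, cycling and super summit elements\<close>

lemma int_Greatest:
  fixes Q :: "int \<Rightarrow> bool"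
  assumes "Q r0" "\<And>r. Q r \<Longrightarrow> r \<le> b"
  shows "Q (GREATEST r. Q r)" and "\<And>r. Q r \<Longrightarrow> r \<le> (GREATEST r. Q r)"
proof -
  define m where "m = Max {r \<in> {r0..b}. Q r}"
  have fin: "finite {r \<in> {r0..b}. Q r}" by (rule finite_subset[of _ "{r0..b}"]) auto
  moreover have "r0 \<in> {r \<in> {r0..b}. Q r}" using assms by auto
  ultimately have m: "m \<in> {r \<in> {r0..b}. Q r}" unfolding m_def by (intro Max_in) auto
  have max: "r \<le> m" if "Q r" for r
  proof (cases "r0 \<le> r")
    case True
    then show ?thesis unfolding m_def using that assms(2) fin by (intro Max_ge) auto
  qed (use m in auto)
  have "(GREATEST r. Q r) = m"
    using m max by (intro Greatest_equality) auto
  with m max show "Q (GREATEST r. Q r)" "\<And>r. Q r \<Longrightarrow> r \<le> (GREATEST r. Q r)" by auto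
qed

lemma finite_range_repeats:
  fixes s :: "nat \<Rightarrow> 'b"
  assumes "finite B" "\<And>n. s n \<in> B"
  obtains i j where "i < j" "s i = s j"
proof -
  have "finite (range s)" using assms by (meson finite_subset image_subsetI)
  then have "\<not> inj s" using finite_imageD infinite_UNIV_nat by blast
  then show ?thesis using that by (metis injI linorder_neqE_nat)
qed

lemma funpow_closed: "(\<And>x. x \<in> Q \<Longrightarrow> T x \<in> Q) \<Longrightarrow> x \<in> Q \<Longrightarrow> (T ^^ n) x \<in> Q"
  by (induction n) auto

lemma funpow_mult_fixed: "(T ^^ k) x = x \<Longrightarrow> (T ^^ (k * m)) x = x"
  by (induction m) (auto simp: funpow_add)

text \<open>Some iterate repeats by finiteness, and injectivity cancels the part of the orbit before
  the repetition.\<close>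

lemma finite_inj_on_periodic:
  assumes "finite Q" "\<And>x. x \<in> Q \<Longrightarrow> T x \<in> Q" "inj_on T Q" "y \<in> Q"
  obtains m where "m \<ge> 1" "(T ^^ m) y = y"
proof -
  have inj: "inj_on (T ^^ n) Q" for n
  proof (induction n)
    case (Suc n)
    have "(T ^^ n) ` Q \<subseteq> Q" using funpow_closed[of Q T, OF assms(2)] by blast
    then show ?case
      unfolding funpow.simps by (intro comp_inj_on Suc inj_on_subset[OF assms(3)])
  qed auto
  obtain i j where ij: "i < j" "(T ^^ i) y = (T ^^ j) y"
    by (rule finite_range_repeats[OF assms(1) funpow_closed[of Q T, OF assms(2,4)]])
  have "T ^^ j = T ^^ i \<circ> T ^^ (j - i)"
    using ij(1) by (simp flip: funpow_add)
  then have "(T ^^ i) ((T ^^ (j - i)) y) = (T ^^ i) y"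
    using ij(2) by (metis comp_apply)
  then have "(T ^^ (j - i)) y = y"
    using inj assms(4) funpow_closed[of Q T, OF assms(2,4)] by (meson inj_onD)
  with ij that[of "j - i"] show ?thesis by simp
qed

context garside_group
begin

section \<open>Finiteness of divisibility intervals\<close>

lemma mprod_P: "set as \<subseteq> P \<Longrightarrow> mprod G as \<in> P"
  by (induction as) (auto simp: mprod_def)

lemma mprod_Cons: "mprod G (a # as) = a \<otimes> mprod G as"
  by (simp add: mprod_def)

lemma mprod_append: "set as \<subseteq> P \<Longrightarrow> set bs \<subseteq> P \<Longrightarrow> mprod G (as @ bs) = mprod G as \<otimes> mprod G bs"
  using mprod_P by (induction as) (auto simp: mprod_def m_assoc)

text \<open>If a product of elements of \<open>P\<close> is an atom, that atom occurs among the
  factors; so every generating set contains all atoms.\<close>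

lemma finite_atoms: "finite (atoms (G\<lparr>carrier := P\<rparr>))"
proof -
  let ?M = "G\<lparr>carrier := P\<rparr>"
  obtain S where S: "finite S" "S \<subseteq> P" "\<And>a. a \<in> P \<Longrightarrow> \<exists>as. set as \<subseteq> S \<and> mprod G as = a"
    using garside_monoid.finitely_generated[OF garside]
    by (auto simp: finitely_generated_monoid_def monoid_generated_by_def mprod_def)
  have atomD: "a \<in> P \<and> a \<noteq> \<one>" if "a \<in> atoms ?M" for a
    using that by (simp only: atoms_def mem_Collect_eq) simp
  have atom_mult: "b = \<one> \<or> c = \<one>" if "b \<otimes> c \<in> atoms ?M" "b \<in> P" "c \<in> P" for b c
  proof -
    have "\<one>\<^bsub>?M\<^esub> = \<one>" "(\<otimes>\<^bsub>?M\<^esub>) = (\<otimes>)" "carrier ?M = P" by simp_all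
    note eqs = this
    show ?thesis using that unfolding atoms_def eqs by blast
  qed
  have in_set: "mprod G as \<in> set as" if "set as \<subseteq> P" "mprod G as \<in> atoms ?M" for as
    using that
  proof (induction as)
    case Nil
    then show ?case using atomD[of \<one>] by (simp add: mprod_def)
  next
    case (Cons b bs)
    have P: "b \<in> P" "mprod G bs \<in> P" using Cons mprod_P[of bs] by auto
    with Cons(3) have "b = \<one> \<or> mprod G bs = \<one>"
      using atom_mult unfolding mprod_Cons by blast
    then show ?case
      using Cons P by (auto simp: mprod_Cons)
  qed
  have "atoms ?M \<subseteq> S"
  proof
    fix a assume a: "a \<in> atoms ?M"
    then have "a \<in> P" using atomD by blast
    with S obtain as where "set as \<subseteq> S" "mprod G as = a" by blast
    moreover have "a \<in> set as" using in_set[of as] calculation a S(2) by (metis subset_trans)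
    ultimately show "a \<in> S" by blast
  qed
  with S show ?thesis using finite_subset by blast
qed

text \<open>Extending an atomic expression of a divisor to one of \<open>b\<close> shows that each
  divisor is a product of at most \<open>N\<close> atoms, and there are finitely many atoms.\<close>

lemma finite_interval_P:
  assumes "b \<in> P"
  shows "finite {p \<in> P. p \<preceq> b}"
proof -
  let ?M = "G\<lparr>carrier := P\<rparr>"
  let ?A = "atoms ?M"
  have atomic: "atomic_monoid ?M" by (rule garside_monoid.atomic[OF garside])
  have A: "?A \<subseteq> P" unfolding atoms_def by force
  have gen: "\<exists>as. set as \<subseteq> ?A \<and> mprod G as = a" if "a \<in> P" for a
    using atomic that by (auto simp: atomic_monoid_def monoid_generated_by_def mprod_def)
  have "max_atom_length ?M b < \<infinity>" using atomic assms by (simp add: atomic_monoid_def)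
  then obtain N where N: "max_atom_length ?M b = enat N" by auto
  have len: "length as \<le> N" if "set as \<subseteq> ?A" "mprod G as = b" for as
  proof -
    have "enat (length as) \<le> max_atom_length ?M b"
      unfolding max_atom_length_def using that by (intro Sup_upper) (auto simp: mprod_def)
    with N show ?thesis by simp
  qed
  have "{p \<in> P. p \<preceq> b} \<subseteq> mprod G ` {as. set as \<subseteq> ?A \<and> length as \<le> N}"
  proof
    fix p assume "p \<in> {p \<in> P. p \<preceq> b}"
    then obtain c where c: "p \<in> P" "c \<in> P" "p \<otimes> c = b" by (auto simp: le_left_def)
    then obtain as bs where as: "set as \<subseteq> ?A" "mprod G as = p" "set bs \<subseteq> ?A" "mprod G bs = c"
      using gen by metis
    then have "mprod G (as @ bs) = b" using A c by (subst mprod_append) auto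
    with as have "length (as @ bs) \<le> N" by (intro len) auto
    with as show "p \<in> mprod G ` {as. set as \<subseteq> ?A \<and> length as \<le> N}" by auto
  qed
  then show ?thesis
    using finite_lists_length_le[OF finite_atoms] finite_surj by blast
qed

lemma finite_interval:
  assumes "a \<in> carrier G" "b \<in> carrier G"
  shows "finite {x \<in> carrier G. a \<preceq> x \<and> x \<preceq> b}"
proof (cases "a \<preceq> b")
  case True
  then have "inv a \<otimes> b \<in> P" using assms by (simp add: le_iff)
  have "{x \<in> carrier G. a \<preceq> x \<and> x \<preceq> b} \<subseteq> (\<lambda>p. a \<otimes> p) ` {p \<in> P. p \<preceq> inv a \<otimes> b}"
  proof
    fix x assume "x \<in> {x \<in> carrier G. a \<preceq> x \<and> x \<preceq> b}"
    then have x: "x \<in> carrier G" "a \<preceq> x" "x \<preceq> b" by auto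
    then have "inv a \<otimes> x \<in> P" "inv a \<otimes> x \<preceq> inv a \<otimes> b" using assms by (auto simp: le_iff inv_mult_group m_assoc)
    moreover have "x = a \<otimes> (inv a \<otimes> x)" using x assms by simp
    ultimately show "x \<in> (\<lambda>p. a \<otimes> p) ` {p \<in> P. p \<preceq> inv a \<otimes> b}" by blast
  qed
  then show ?thesis
    using finite_interval_P[OF \<open>inv a \<otimes> b \<in> P\<close>] finite_surj by blast
next
  case False
  then have "{x \<in> carrier G. a \<preceq> x \<and> x \<preceq> b} = {}" using le_trans assms by blast
  then show ?thesis by (simp only: finite.emptyI)
qed

lemma finite_simples: "finite simples"
  unfolding simples_def using finite_interval_P[of \<Delta>] by simp

lemma P_simple_prefix:
  assumes "p \<in> P" "p \<noteq> \<one>"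
  shows "\<exists>s\<in>simples. s \<noteq> \<one> \<and> s \<preceq> p"
  using assms
proof (induction rule: P_induct)
  case (mult s p)
  show ?case
  proof (cases "s = \<one>")
    case True
    with mult show ?thesis by auto
  next
    case False
    have "s \<preceq> s \<otimes> p" using mult by (intro le_mult_P) auto
    with False mult(1) show ?thesis by blast
  qed
qed simp

section \<open>Conjugation, the automorphism \<Phi> and stable sets\<close>

definition cj :: "'a \<Rightarrow> 'a \<Rightarrow> 'a"
  where "cj x g = inv x \<otimes> g \<otimes> x"

lemma cj_closed [simp, intro]: "x \<in> carrier G \<Longrightarrow> g \<in> carrier G \<Longrightarrow> cj x g \<in> carrier G"
  by (simp add: cj_def)

lemma cj_cj: "x \<in> carrier G \<Longrightarrow> y \<in> carrier G \<Longrightarrow> g \<in> carrier G \<Longrightarrow> cj y (cj x g) = cj (x \<otimes> y) g"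
  by (simp add: cj_def m_assoc inv_mult_group)

lemma cj_one [simp]: "g \<in> carrier G \<Longrightarrow> cj \<one> g = g"
  by (simp add: cj_def)

lemma inv_cj: "x \<in> carrier G \<Longrightarrow> g \<in> carrier G \<Longrightarrow> inv (cj x g) = cj x (inv g)"
  by (simp add: cj_def m_assoc inv_mult_group)

lemma cj_eq_iff:
  assumes "x \<in> carrier G" "y \<in> carrier G" "g \<in> carrier G"
  shows "cj x g = cj y g \<longleftrightarrow> x \<otimes> inv y \<otimes> g = g \<otimes> (x \<otimes> inv y)"
proof -
  have "cj x g = cj y g \<longleftrightarrow> x \<otimes> cj x g \<otimes> inv y = x \<otimes> cj y g \<otimes> inv y"
    using assms by simp
  also have "\<dots> \<longleftrightarrow> g \<otimes> (x \<otimes> inv y) = x \<otimes> inv y \<otimes> g"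
    using assms by (simp add: cj_def m_assoc)
  finally show ?thesis by auto
qed

lemma commute_inv:
  assumes "z \<in> carrier G" "f \<in> carrier G" "z \<otimes> f = f \<otimes> z"
  shows "z \<otimes> inv f = inv f \<otimes> z"
proof -
  have "inv f \<otimes> (f \<otimes> z) \<otimes> inv f = inv f \<otimes> (z \<otimes> f) \<otimes> inv f"
    using assms(3) by simp
  then show ?thesis using assms(1,2) by (simp add: m_assoc)
qed

lemma conj_class_eq: "conj_class g = {cj x g | x. x \<in> carrier G}"
  by (simp add: conj_class_def cj_def)

lemma conj_class_cj:
  assumes "x \<in> carrier G" "g \<in> carrier G"
  shows "conj_class (cj x g) = conj_class g"
proof -
  have "cj y g = cj (inv x \<otimes> y) (cj x g)" if "y \<in> carrier G" for y
    using that assms by (simp add: cj_cj)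
  moreover have "inv x \<otimes> y \<in> carrier G" if "y \<in> carrier G" for y
    using that assms by simp
  ultimately have "conj_class g \<subseteq> conj_class (cj x g)"
    unfolding conj_class_eq by blast
  moreover have "cj y (cj x g) = cj (x \<otimes> y) g" "x \<otimes> y \<in> carrier G" if "y \<in> carrier G" for y
    using that assms by (simp_all add: cj_cj)
  then have "conj_class (cj x g) \<subseteq> conj_class g"
    unfolding conj_class_eq by blast
  ultimately show ?thesis by blast
qed

definition twist :: "'a \<Rightarrow> int \<Rightarrow> 'a \<Rightarrow> 'a"
  where "twist h k x = h \<otimes> x \<otimes> D (- k)"

lemma twist_closed [simp, intro]: "h \<in> carrier G \<Longrightarrow> x \<in> carrier G \<Longrightarrow> twist h k x \<in> carrier G"
  by (simp add: twist_def)

lemma funpow_twist_closed [simp, intro]: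
  "h \<in> carrier G \<Longrightarrow> x \<in> carrier G \<Longrightarrow> (twist h k ^^ i) x \<in> carrier G"
  by (rule funpow_closed) auto

lemma twist_mono_iff [simp]:
  "h \<in> carrier G \<Longrightarrow> x \<in> carrier G \<Longrightarrow> y \<in> carrier G \<Longrightarrow> twist h k x \<preceq> twist h k y \<longleftrightarrow> x \<preceq> y"
  by (simp add: twist_def)

lemma twist_meet:
  assumes "h \<in> carrier G" "x \<in> carrier G" "y \<in> carrier G"
  shows "twist h k (x \<triangle> y) = twist h k x \<triangle> twist h k y"
  using assms by (simp add: twist_def meet_mult_left meet_mult_D)

lemma twist_D: "h \<in> carrier G \<Longrightarrow> x \<in> carrier G \<Longrightarrow> twist h k (x \<otimes> D j) = twist h k x \<otimes> D j"
  by (simp add: twist_def m_assoc add.commute)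

lemma twist_commute:
  assumes "h \<in> carrier G" "x \<in> carrier G" "z \<in> carrier G" "z \<otimes> h = h \<otimes> z"
  shows "twist h k (z \<otimes> x) = z \<otimes> twist h k x"
  using assms by (simp add: twist_def flip: m_assoc)

lemma funpow_twist:
  assumes "h \<in> carrier G" "x \<in> carrier G"
  shows "(twist h k ^^ i) x = h [^] i \<otimes> x \<otimes> D (- (int i * k))"
proof (induction i)
  case (Suc i)
  have "h \<otimes> h [^] i = h [^] i \<otimes> h"
    using assms by (metis nat_pow_Suc nat_pow_Suc2)
  with Suc assms show ?case
    by (simp add: twist_def m_assoc algebra_simps flip: m_assoc[of h "h [^] i"])
qed (use assms in simp)

text \<open>Carrying \<open>D (- k)\<close> from the left of the conjugate to its right is a
  conjugation by \<open>D k\<close>, which preserves \<open>P\<close>. A bound on a conjugate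
  thereby becomes an order relation between \<open>x\<close> and its image under a lattice
  automorphism.\<close>

lemma D_le_cj_iff:
  assumes "h \<in> carrier G" "x \<in> carrier G"
  shows "D k \<preceq> cj x h \<longleftrightarrow> x \<preceq> twist h k x"
  using assms conj_D_P_iff[of "inv x \<otimes> h \<otimes> x \<otimes> D (- k)" k]
  by (simp add: le_iff cj_def twist_def m_assoc)

text \<open>Closure under all moves used to improve a conjugator. A point built from
  \<open>x\<close> by these moves lies in every stable set containing \<open>x\<close>; this is how
  properties already reached for some elements of \<open>H\<close> survive the treatment of
  another.\<close>

definition stable :: "'a set \<Rightarrow> 'a set \<Rightarrow> bool"
  where "stable H A \<longleftrightarrow> A \<subseteq> carrier G \<and> (\<forall>x\<in>A. \<forall>y\<in>A. x \<triangle> y \<in> A)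
    \<and> (\<forall>x\<in>A. \<forall>j. x \<otimes> D j \<in> A) \<and> (\<forall>h\<in>H. \<forall>x\<in>A. h \<otimes> x \<in> A)"

lemma stable_twist: "stable H A \<Longrightarrow> h \<in> H \<Longrightarrow> x \<in> A \<Longrightarrow> twist h k x \<in> A"
  by (simp add: stable_def twist_def)

lemma stable_Int: "stable H A \<Longrightarrow> stable H B \<Longrightarrow> stable H (A \<inter> B)"
  by (auto simp: stable_def)

text \<open>The condition is \<open>x \<preceq> twist f k x\<close>. It passes to meets because
  \<open>twist f k\<close> preserves them, and to the other moves because \<open>twist f k\<close>
  commutes with them.\<close>

lemma stable_le_twist:
  assumes f: "f \<in> carrier G" and H: "H \<subseteq> carrier G" "\<And>h. h \<in> H \<Longrightarrow> h \<otimes> f = f \<otimes> h"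
  shows "stable H {x \<in> carrier G. D k \<preceq> cj x f}"
proof -
  have "x \<triangle> y \<preceq> twist f k (x \<triangle> y)"
    if "x \<in> carrier G" "y \<in> carrier G" "x \<preceq> twist f k x" "y \<preceq> twist f k y" for x y
    unfolding twist_meet[OF f that(1,2)] using that f by (intro meet_mono) auto
  then show ?thesis
    using assms by (auto simp: stable_def D_le_cj_iff twist_D twist_commute subset_iff)
qed

text \<open>
  The iterates of \<open>y \<mapsto> x \<triangle> \<Phi> y\<close> with \<open>\<Phi> = twist h k\<close>, started at \<open>x\<close>, are the meets of
  \<open>x, \<Phi> x, \<dots>, \<Phi>\<^sup>N x\<close>; being bounded below they reach a point \<open>y \<preceq> \<Phi> y\<close>.
\<close>

lemma inf_step:
  assumes h: "h \<in> H" "H \<subseteq> carrier G" and x: "x \<in> carrier G" and l: "l \<in> carrier G"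
    and bound: "\<And>i. l \<preceq> (twist h k ^^ i) x"
  shows "\<exists>y\<in>carrier G. D k \<preceq> cj y h \<and> (\<forall>A. stable H A \<longrightarrow> x \<in> A \<longrightarrow> y \<in> A)"
proof -
  define s where "s n = ((\<lambda>y. x \<triangle> twist h k y) ^^ n) x" for n
  have s0: "s 0 = x" and sS: "s (Suc n) = x \<triangle> twist h k (s n)" for n by (auto simp: s_def)
  have hG: "h \<in> carrier G" using h by auto
  have sG [simp]: "s n \<in> carrier G" for n using x hG by (induction n) (auto simp: s0 sS)
  have dec: "s (Suc n) \<preceq> s n" for n
  proof (induction n)
    case 0
    show ?case using x hG sS[of 0] by (simp add: s0)
  next
    case (Suc n)
    show ?case unfolding sS[of "Suc n"] sS[of n]
      using Suc x hG sS[of n] by (intro meet_mono) auto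
  qed
  \<comment> \<open>All iterates \<open>i\<close> are treated at once because
    \<open>s (Suc n)\<close> involves the twist of \<open>s n\<close>; only \<open>i = 0\<close> is
    used afterwards, to place the chain in a finite interval.\<close>
  have low: "l \<preceq> (twist h k ^^ i) (s n)" for n i
  proof (induction n arbitrary: i)
    case (Suc n)
    have "(twist h k ^^ i) (x \<triangle> y) = (twist h k ^^ i) x \<triangle> (twist h k ^^ i) y"
      if "y \<in> carrier G" for y
      using that x hG by (induction i) (auto simp: twist_meet)
    then have "(twist h k ^^ i) (s (Suc n)) = (twist h k ^^ i) x \<triangle> (twist h k ^^ Suc i) (s n)"
      using hG by (simp add: sS funpow_swap1)
    then show ?case using bound[of i] Suc[of "Suc i"] x l hG by (simp add: le_meet_iff del: funpow.simps)
  qed (simp add: s0 bound)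
  have antimono: "s j \<preceq> s i" if "i \<le> j" for i j
    using that by (induction rule: dec_induct) (auto intro: le_trans[OF dec])
  have "s n \<in> {y \<in> carrier G. l \<preceq> y \<and> y \<preceq> x}" for n
    using low[of 0 n] antimono[of 0 n] by (simp add: s0)
  then obtain i j where ij: "i < j" "s i = s j"
    using finite_range_repeats[OF finite_interval[OF l x]] by blast
  then have "s (Suc i) = s i"
    using antimono[of "Suc i" j] dec[of i] by (intro le_antisym) auto
  then have "s i \<preceq> twist h k (s i)"
    using sS[of i] x hG by (metis meet_le2 sG twist_closed)
  moreover have "s n \<in> A" if "stable H A" "x \<in> A" for A n
    using that h stable_twist[OF that(1)] by (induction n) (auto simp: s0 sS stable_def)
  ultimately show ?thesis
    using hG by (intro bexI[of _ "s i"]) (auto simp: D_le_cj_iff)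
qed

text \<open>Greedy splitting: \<open>s = p \<triangle> \<Delta>\<close> is not 1 since
  \<open>p\<close> has a nontrivial simple prefix, and not \<Delta> by assumption. The rest
  \<open>p'\<close> is again not divisible by \<Delta>, since otherwise \<Delta> would divide
  \<open>s \<otimes> \<Delta>\<close> and hence \<open>p\<close>, and it has fewer left divisors
  than \<open>p\<close>.\<close>

lemma normal_form_exists:
  assumes "p \<in> P" "\<not> \<Delta> \<preceq> p"
  shows "\<exists>ss. set ss \<subseteq> simples - {\<one>, \<Delta>} \<and> mprod G ss = p
    \<and> (\<forall>i<length ss. mprod G (drop i ss) \<triangle> \<Delta> = ss ! i)"
  using assms
proof (induction "card {x \<in> P. x \<preceq> p}" arbitrary: p rule: less_induct)
  case less
  show ?case
  proof (cases "p = \<one>")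
    case True
    then show ?thesis by (intro exI[of _ "[]"]) (simp add: mprod_def)
  next
    case False
    define s where "s = p \<triangle> \<Delta>"
    have sP: "s \<in> P"
      using meet_greatest[of \<one> p \<Delta>] less(2) by (simp add: s_def one_le_iff)
    then have s: "s \<in> simples" "s \<preceq> p"
      using less(2) by (auto simp: simples_iff s_def)
    have s\<Delta>: "s \<noteq> \<Delta>"
      using less(2,3) meet_le1[of p \<Delta>] unfolding s_def by (metis Delta_closed P_carrier)
    have s1: "s \<noteq> \<one>"
    proof -
      obtain t where t: "t \<in> simples" "t \<noteq> \<one>" "t \<preceq> p"
        using P_simple_prefix less(2) False by blast
      then have "t \<preceq> s" unfolding s_def using less(2) by (intro meet_greatest) (auto simp: simples_iff)
      moreover have "\<one> \<preceq> t" using t by (simp add: one_le_iff)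
      ultimately show ?thesis using t le_antisym[of \<one> t] by auto
    qed
    define p' where "p' = inv s \<otimes> p"
    have p': "p' \<in> P" "p = s \<otimes> p'" using s sP less(2) by (auto simp: p'_def le_iff)
    have "\<not> \<Delta> \<preceq> p'"
    proof
      assume "\<Delta> \<preceq> p'"
      then have "D 1 \<preceq> s \<otimes> D 1" "s \<otimes> \<Delta> \<preceq> s \<otimes> p'"
        using sP p' le_mult_D_iff[of \<one> s 1] by (auto simp: one_le_iff)
      then have "\<Delta> \<preceq> p" using p' sP by (auto simp: D_1 intro: le_trans)
      with less(3) show False by simp
    qed
    moreover have "card {x \<in> P. x \<preceq> p'} < card {x \<in> P. x \<preceq> p}"
    proof -
      have "card {x \<in> P. x \<preceq> p'} = card ((\<lambda>x. s \<otimes> x) ` {x \<in> P. x \<preceq> p'})"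
        using sP by (intro card_image[symmetric] inj_onI) auto
      also have "\<dots> < card {x \<in> P. x \<preceq> p}"
      proof (rule psubset_card_mono)
        show "finite {x \<in> P. x \<preceq> p}" using finite_interval_P less(2) by blast
        have "\<one> \<notin> (\<lambda>x. s \<otimes> x) ` {x \<in> P. x \<preceq> p'}"
        proof
          assume "\<one> \<in> (\<lambda>x. s \<otimes> x) ` {x \<in> P. x \<preceq> p'}"
          then obtain x where "x \<in> P" "s \<otimes> x = \<one>" by auto
          then have "inv s = x" using sP by (metis P_carrier inv_cancel_left(1) inv_closed r_one)
          with \<open>x \<in> P\<close> P_units sP s1 show False by auto
        qed
        moreover have "\<one> \<in> {x \<in> P. x \<preceq> p}" using less(2) by (simp add: one_le_iff)
        moreover have "(\<lambda>x. s \<otimes> x) ` {x \<in> P. x \<preceq> p'} \<subseteq> {x \<in> P. x \<preceq> p}"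
          using sP p' by auto
        ultimately show "(\<lambda>x. s \<otimes> x) ` {x \<in> P. x \<preceq> p'} \<subset> {x \<in> P. x \<preceq> p}" by blast
      qed
      finally show ?thesis .
    qed
    ultimately obtain ss where ss: "set ss \<subseteq> simples - {\<one>, \<Delta>}" "mprod G ss = p'"
      "\<forall>i<length ss. mprod G (drop i ss) \<triangle> \<Delta> = ss ! i"
      using less(1)[of p'] p' by blast
    have "mprod G (drop i (s # ss)) \<triangle> \<Delta> = (s # ss) ! i" if "i < length (s # ss)" for i
    proof (cases i)
      case 0
      then show ?thesis using ss(2) p'(2) by (simp add: mprod_Cons s_def)
    next
      case (Suc j)
      then show ?thesis using ss(3) that by auto
    qed
    then show ?thesis
      using ss s s1 s\<Delta> p' by (intro exI[of _ "s # ss"]) (auto simp: mprod_Cons)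
  qed
qed

end

text \<open>If \<Delta> = 1 all powers \<open>D r\<close> coincide, so the maximum and minimum
  defining \<open>inf_exp\<close> and \<open>sup_exp\<close> do not exist. The trivial group is
  treated separately at the end.\<close>

locale nontrivial_garside_group = garside_group +
  assumes Delta_not_one: "\<Delta> \<noteq> \<one>"
begin

text \<open>A violation makes \<open>D (s - r)\<close> a unit of \<open>P\<close>, hence 1; then the
  inverse of \<Delta> equals \<open>D (r - s - 1)\<close>, which lies in \<open>P\<close>, and
  \<Delta> would be a unit too.\<close>

lemma D_le_D_iff: "D r \<preceq> D s \<longleftrightarrow> r \<le> s"
proof
  assume "D r \<preceq> D s"
  then have 1: "D (s - r) \<in> P" by (simp add: le_iff)
  show "r \<le> s"
  proof (rule ccontr)
    assume "\<not> r \<le> s"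
    then have "D (r - s) \<in> P" "D (r - s - 1) \<in> P" by (auto intro: D_P)
    with 1 have eq: "D (s - r) = \<one>" using P_units[of "D (s - r)"] by simp
    have "inv (D 1) = D (s - r) \<otimes> D (r - s - 1)" by simp
    also have "\<dots> = D (r - s - 1)" by (simp only: eq l_one int_pow_closed Delta_closed)
    finally have "inv (D 1) \<in> P" using \<open>D (r - s - 1) \<in> P\<close> by (simp only:)
    with P_units[of "D 1"] Delta_not_one show False by (auto simp: D_1)
  qed
qed (rule D_mono)

lemma D_le_iff_inf:
  assumes "g \<in> carrier G"
  shows "D r \<preceq> g \<longleftrightarrow> r \<le> inf_exp g"
proof -
  obtain k where k: "D (- k) \<preceq> g" "g \<preceq> D k" using bounded_D[OF assms] by blast
  have "r \<le> k" if "D r \<preceq> g" for r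
    using le_trans[OF that k(2)] by (simp add: D_le_D_iff)
  with int_Greatest[of "\<lambda>r. D r \<preceq> g" "- k" k] k
  have *: "D (inf_exp g) \<preceq> g" "\<And>r. D r \<preceq> g \<Longrightarrow> r \<le> inf_exp g"
    by (auto simp: inf_exp_def)
  show ?thesis
    using *(2) le_trans[OF D_mono *(1)] by auto
qed

lemma sup_exp_eq:
  assumes "g \<in> carrier G"
  shows "sup_exp g = - inf_exp (inv g)"
  unfolding sup_exp_def
  using assms by (intro Least_equality) (auto simp: le_D_iff_inv D_le_iff_inf)

text \<open>For a normal form with exponent \<open>r\<close> and first factor \<open>s\<close>, the
  meet is \<open>D r \<otimes> s \<otimes> D (- r)\<close>, and conjugation by it moves
  \<open>s\<close> to the end. Every normal form of \<open>g\<close> gives this same value, so the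
  definite description is resolved without first proving normal forms unique.\<close>

lemma cycling_eq:
  assumes g: "g \<in> carrier G"
  shows "cycling g = cj (g \<otimes> D (- inf_exp g) \<triangle> D 1) g"
proof -
  have val: "(case ss of [] \<Rightarrow> g | s # ss' \<Rightarrow> D r \<otimes> mprod G ss' \<otimes> tau_pow (- r) s)
      = cj (g \<otimes> D (- inf_exp g) \<triangle> D 1) g" if nf: "normal_form g r ss" for r ss
  proof (cases ss)
    case Nil
    then have "g = D r" using nf by (simp add: normal_form_def mprod_def)
    moreover have "inf_exp (D r) = r"
      using D_le_iff_inf[of "D r"] by (simp add: D_le_D_iff) (metis order_antisym order_refl)
    moreover have "\<one> \<triangle> D 1 = \<one>"
      using meet_le1[of \<one> "D 1"] meet_greatest[of \<one> \<one> "D 1"] D_P[of 1]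
      by (intro le_antisym) (auto simp: one_le_iff)
    ultimately show ?thesis using Nil by simp
  next
    case (Cons s ss')
    define p where "p = mprod G ss"
    have ssP: "set ss \<subseteq> P" "s \<in> P" "set ss' \<subseteq> P"
      using nf Cons by (auto simp: normal_form_def)
    then have P: "p \<in> P" "mprod G ss' \<in> P" using mprod_P by (auto simp: p_def)
    have p: "p = s \<otimes> mprod G ss'" by (simp add: p_def Cons mprod_Cons)
    have gp: "g = D r \<otimes> p" using nf by (simp add: normal_form_def p_def)
    have s: "s = p \<triangle> D 1" "s \<noteq> \<Delta>" using nf by (auto simp: normal_form_def p_def Cons D_1)
    have "inf_exp g = r"
    proof (rule antisym)
      show "r \<le> inf_exp g"
        using P le_mult_P[of "D r" p] by (simp add: gp flip: D_le_iff_inf)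
      show "inf_exp g \<le> r"
      proof (rule ccontr)
        assume "\<not> inf_exp g \<le> r"
        then have "D (r + 1) \<preceq> D r \<otimes> p"
          using g by (simp add: D_le_iff_inf flip: gp)
        then have "D 1 \<preceq> p" using P le_mult_left_iff[of "D r" "D 1" p] by simp
        then have "D 1 \<preceq> s" unfolding s(1) using P by (intro meet_greatest) auto
        then have "s = D 1" using P le_antisym[of s "D 1"] by (simp add: s(1))
        with s(2) show False by (simp add: D_1)
      qed
    qed
    moreover have "g \<otimes> D (- r) \<triangle> D 1 = D r \<otimes> s \<otimes> D (- r)"
      unfolding s(1) gp using P by (simp add: meet_mult_left meet_mult_D)
    ultimately show ?thesis
      using ssP P by (simp add: Cons gp p cj_def tau_pow_def m_assoc inv_mult_group)
  qed
  define p where "p = D (- inf_exp g) \<otimes> g"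
  have "D (inf_exp g) \<preceq> g" "\<not> D (inf_exp g + 1) \<preceq> g" using g by (auto simp: D_le_iff_inf)
  moreover have "D (inf_exp g + 1) \<preceq> g \<longleftrightarrow> \<Delta> \<preceq> p"
    using g le_mult_left_iff[of "D (inf_exp g)" "D 1" p] by (simp add: p_def) (simp add: D_1)
  ultimately have p: "p \<in> P" "\<not> \<Delta> \<preceq> p" using g by (auto simp: p_def le_iff)
  then obtain ss where "set ss \<subseteq> simples - {\<one>, \<Delta>}" "mprod G ss = p"
    "\<forall>i<length ss. mprod G (drop i ss) \<triangle> \<Delta> = ss ! i"
    using normal_form_exists by blast
  then have nf: "normal_form g (inf_exp g) ss"
    using g by (simp add: normal_form_def p_def)
  show ?thesis
    unfolding cycling_def using val nf val[OF nf] by (intro the_equality) metis+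
qed

text \<open>Otherwise \<open>x \<preceq> twist g k x\<close> with \<open>k = sup_exp g + 1\<close>,
  and iterating gives \<open>x \<preceq> g [^] i \<otimes> x \<otimes> D (- (int i * k))\<close>.
  The powers of \<open>g\<close> gain at most \<open>sup_exp g\<close> per step, so the right side
  sinks by one power of \<Delta> each time; \<open>i = 2 * c + 1\<close> steps suffice for a
  contradiction. This makes \<open>summit_inf\<close> an attained maximum.\<close>

lemma inf_cj_le_sup:
  assumes x: "x \<in> carrier G" and g: "g \<in> carrier G"
  shows "inf_exp (cj x g) \<le> sup_exp g"
proof (rule ccontr)
  assume neg: "\<not> inf_exp (cj x g) \<le> sup_exp g"
  define k where "k = sup_exp g + 1"
  have "D k \<preceq> cj x g" using neg x g by (simp add: D_le_iff_inf k_def)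
  then have tw: "x \<preceq> twist g k x" using x g by (simp add: D_le_cj_iff)
  have it: "x \<preceq> (twist g k ^^ i) x" for i
  proof (induction i)
    case (Suc i)
    then have "twist g k x \<preceq> (twist g k ^^ Suc i) x" using x g by simp
    with tw show ?case using le_trans x by blast
  qed (use x in simp)
  have gi: "g [^] i \<preceq> D (int i * sup_exp g)" for i :: nat
  proof (induction i)
    case (Suc i)
    have "g \<preceq> D (sup_exp g)" using g by (simp add: sup_exp_eq le_D_iff_inv D_le_iff_inf)
    from mult_le_D[OF Suc this] show ?case using g by (simp add: algebra_simps)
  qed simp
  obtain c where c: "c \<ge> 0" "D (- c) \<preceq> x" "x \<preceq> D c" using bounded_D[OF x] by blast
  define i where "i = nat (2 * c + 1)"
  have "D (- c) \<preceq> g [^] i \<otimes> x \<otimes> D (- (int i * k))"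
    using le_trans[OF c(2) it[of i]] x g by (simp add: funpow_twist)
  then have "D (int i * k - c) \<preceq> g [^] i \<otimes> x"
    using x g le_mult_D_swap[of "D (- c)" "g [^] i \<otimes> x" "- (int i * k)"] by simp
  also have "g [^] i \<otimes> x \<preceq> D (int i * sup_exp g + c)"
    using x g by (intro mult_le_D gi c) auto
  finally have "int i * k - c \<le> int i * sup_exp g + c" by (simp add: D_le_D_iff)
  then have "int i \<le> 2 * c" by (simp add: k_def algebra_simps)
  then show False using c(1) by (simp add: i_def)
qed

section \<open>Summit values and their conjugators\<close>

lemma summit_inf_props:
  assumes g: "g \<in> carrier G"
  shows "\<exists>x\<in>carrier G. inf_exp (cj x g) = summit_inf g"
    and "\<And>x. x \<in> carrier G \<Longrightarrow> inf_exp (cj x g) \<le> summit_inf g"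
proof -
  let ?Q = "\<lambda>r. r \<in> inf_exp ` conj_class g"
  have "?Q (inf_exp (cj \<one> g))" unfolding conj_class_eq by blast
  moreover have "r \<le> sup_exp g" if "?Q r" for r
    using that inf_cj_le_sup g by (auto simp: conj_class_eq)
  ultimately have *: "?Q (summit_inf g)" "\<And>r. ?Q r \<Longrightarrow> r \<le> summit_inf g"
    unfolding summit_inf_def using int_Greatest[of ?Q] by blast+
  from *(1) show "\<exists>x\<in>carrier G. inf_exp (cj x g) = summit_inf g" by (auto simp: conj_class_eq)
  show "inf_exp (cj x g) \<le> summit_inf g" if "x \<in> carrier G" for x
    using *(2) that unfolding conj_class_eq by blast
qed

lemma summit_sup_eq:
  assumes g: "g \<in> carrier G"
  shows "summit_sup g = - summit_inf (inv g)"
proof -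
  have sup: "sup_exp (cj x g) = - inf_exp (cj x (inv g))" if "x \<in> carrier G" for x
    using g that by (simp add: sup_exp_eq inv_cj)
  obtain x where x: "x \<in> carrier G" "inf_exp (cj x (inv g)) = summit_inf (inv g)"
    using summit_inf_props(1) g by blast
  show ?thesis
    unfolding summit_sup_def
  proof (rule Least_equality)
    show "- summit_inf (inv g) \<in> sup_exp ` conj_class g"
    proof (rule image_eqI)
      show "- summit_inf (inv g) = sup_exp (cj x g)" using sup x by simp
      show "cj x g \<in> conj_class g" unfolding conj_class_eq using x(1) by blast
    qed
    show "- summit_inf (inv g) \<le> s" if "s \<in> sup_exp ` conj_class g" for s
      using that sup summit_inf_props(2)[of "inv g"] g unfolding conj_class_eq by auto
  qed
qed

text \<open>The supremum is handled as minus the infimum of the inverse, so both halves have the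
  form treated in \<open>stable_le_twist\<close>. Inequalities suffice because
  \<open>summit_inf\<close> is maximal.\<close>

definition super_conjugators :: "'a \<Rightarrow> 'a set"
  where "super_conjugators g = {x \<in> carrier G. D (summit_inf g) \<preceq> cj x g}
    \<inter> {x \<in> carrier G. D (summit_inf (inv g)) \<preceq> cj x (inv g)}"

definition ultra_conjugators :: "'a \<Rightarrow> 'a set"
  where "ultra_conjugators g = {x \<in> super_conjugators g. \<exists>k\<ge>1. (cycling ^^ k) (cj x g) = cj x g}"

lemma super_conjugators_carrier: "x \<in> super_conjugators g \<Longrightarrow> x \<in> carrier G"
  by (simp add: super_conjugators_def)

lemma super_conjugators_iff:
  assumes "g \<in> carrier G" "x \<in> carrier G"
  shows "x \<in> super_conjugators g \<longleftrightarrow> inf_exp (cj x g) = summit_inf g \<and> sup_exp (cj x g) = summit_sup g"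
  using assms summit_inf_props(2)[of g x] summit_inf_props(2)[of "inv g" x]
  by (auto simp: super_conjugators_def D_le_iff_inf summit_sup_eq sup_exp_eq inv_cj)

lemma ultra_summit_element_cj:
  assumes "g \<in> carrier G" "x \<in> carrier G"
  shows "ultra_summit_element (cj x g) \<longleftrightarrow> x \<in> ultra_conjugators g"
proof -
  have "cj x g \<in> conj_class (cj x g)"
    using assms cj_one[of "cj x g"] unfolding conj_class_eq by (metis (mono_tags, lifting) cj_closed mem_Collect_eq one_closed)
  moreover have "summit_inf (cj x g) = summit_inf g" "summit_sup (cj x g) = summit_sup g"
    using assms by (simp_all add: summit_inf_def summit_sup_def conj_class_cj)
  ultimately show ?thesis
    using assms by (simp add: ultra_summit_element_def ultra_summit_set_def super_summit_set_def ultra_conjugators_def super_conjugators_iff)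
qed

lemma super_conjugators_stable:
  assumes f: "f \<in> carrier G" and H: "H \<subseteq> carrier G" "\<And>h. h \<in> H \<Longrightarrow> h \<otimes> f = f \<otimes> h"
  shows "stable H (super_conjugators f)"
proof -
  have "h \<otimes> inv f = inv f \<otimes> h" if "h \<in> H" for h
    using H f that by (intro commute_inv) auto
  then show ?thesis
    unfolding super_conjugators_def by (intro stable_Int stable_le_twist f H inv_closed)
qed

end

section \<open>Ultra summit elements\<close>

context nontrivial_garside_group
begin

text \<open>
  Conjugation by \<open>x\<close> followed by cycling is conjugation by \<open>transport h r x\<close>, for \<open>r\<close> the infimum
  of the conjugate. Its advantage over the usual transport of simple elements is that it visibly
  preserves meets.
\<close>

definition transport :: "'a \<Rightarrow> int \<Rightarrow> 'a \<Rightarrow> 'a"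
  where "transport h r x = twist h r x \<triangle> x \<otimes> D 1"

lemma transport_closed [simp, intro]:
  "h \<in> carrier G \<Longrightarrow> x \<in> carrier G \<Longrightarrow> transport h r x \<in> carrier G"
  by (simp add: transport_def)

lemma funpow_transport_closed [simp, intro]:
  "h \<in> carrier G \<Longrightarrow> x \<in> carrier G \<Longrightarrow> (transport h r ^^ n) x \<in> carrier G"
  by (rule funpow_closed) auto

text \<open>Pulling \<open>x\<close> out of the meet leaves exactly the conjugator of
  \<open>cycling_eq\<close>.\<close>

lemma cj_transport:
  assumes "h \<in> carrier G" "x \<in> carrier G" "inf_exp (cj x h) = r"
  shows "cj (transport h r x) h = cycling (cj x h)"
proof -
  have "transport h r x = x \<otimes> (cj x h \<otimes> D (- r) \<triangle> D 1)"
    using assms(1,2) by (simp add: transport_def twist_def meet_mult_left cj_def m_assoc)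
  then show ?thesis
    using assms by (simp add: cycling_eq cj_cj)
qed

lemma meet_meet_swap:
  assumes "a \<in> carrier G" "b \<in> carrier G" "c \<in> carrier G" "d \<in> carrier G"
  shows "(a \<triangle> b) \<triangle> (c \<triangle> d) = (a \<triangle> c) \<triangle> (b \<triangle> d)"
  using assms by (intro meet_eqI) (auto simp: le_meet_iff)

lemma transport_meet:
  assumes "h \<in> carrier G" "x \<in> carrier G" "y \<in> carrier G"
  shows "transport h r (x \<triangle> y) = transport h r x \<triangle> transport h r y"
  using assms by (simp add: transport_def twist_meet meet_mult_D meet_meet_swap)

lemma transport_mult_D:
  assumes "h \<in> carrier G" "x \<in> carrier G"
  shows "transport h r (x \<otimes> D j) = transport h r x \<otimes> D j"
  using assms by (simp add: transport_def twist_D meet_mult_D m_assoc add.commute)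

lemma transport_commute:
  assumes "h \<in> carrier G" "x \<in> carrier G" "z \<in> carrier G" "z \<otimes> h = h \<otimes> z"
  shows "transport h r (z \<otimes> x) = z \<otimes> transport h r x"
  using assms by (simp add: transport_def twist_commute meet_mult_left m_assoc)

lemma
  assumes h: "h \<in> carrier G" and x: "x \<in> carrier G"
  shows funpow_transport_meet: "y \<in> carrier G \<Longrightarrow>
      (transport h r ^^ n) (x \<triangle> y) = (transport h r ^^ n) x \<triangle> (transport h r ^^ n) y"
    and funpow_transport_mult_D: "(transport h r ^^ n) (x \<otimes> D j) = (transport h r ^^ n) x \<otimes> D j"
    and funpow_transport_commute: "z \<in> carrier G \<Longrightarrow> z \<otimes> h = h \<otimes> z \<Longrightarrow>
      (transport h r ^^ n) (z \<otimes> x) = z \<otimes> (transport h r ^^ n) x"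
  using assms by (induction n) (auto simp: transport_meet transport_mult_D transport_commute)

lemma stable_transport:
  assumes "stable H A" "h \<in> H" "x \<in> A"
  shows "transport h r x \<in> A"
  using assms stable_twist[OF assms] by (auto simp: stable_def transport_def)

lemma funpow_transport_super_conjugators:
  assumes f: "f \<in> carrier G" and x: "x \<in> super_conjugators f"
  shows "(transport f (summit_inf f) ^^ n) x \<in> super_conjugators f
    \<and> cj ((transport f (summit_inf f) ^^ n) x) f = (cycling ^^ n) (cj x f)"
proof (induction n)
  case (Suc n)
  have "stable {f} (super_conjugators f)" using f by (intro super_conjugators_stable) auto
  with Suc stable_transport have "(transport f (summit_inf f) ^^ Suc n) x \<in> super_conjugators f" by simp
  moreover have "cj ((transport f (summit_inf f) ^^ Suc n) x) f = (cycling ^^ Suc n) (cj x f)"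
  proof -
    let ?u = "(transport f (summit_inf f) ^^ n) x"
    have "?u \<in> super_conjugators f" "?u \<in> carrier G" using Suc super_conjugators_carrier by blast+
    with f have "inf_exp (cj ?u f) = summit_inf f" by (simp add: super_conjugators_iff)
    with f \<open>?u \<in> carrier G\<close> Suc show ?thesis by (simp add: cj_transport)
  qed
  ultimately show ?case by blast
qed (use x in simp)

lemma ultra_conjugators_iff:
  assumes "f \<in> carrier G"
  shows "x \<in> ultra_conjugators f \<longleftrightarrow> x \<in> super_conjugators f \<and> (\<exists>k\<ge>1. cj ((transport f (summit_inf f) ^^ k) x) f = cj x f)"
proof (cases "x \<in> super_conjugators f")
  case True
  then have "cj ((transport f (summit_inf f) ^^ k) x) f = (cycling ^^ k) (cj x f)" for k
    using funpow_transport_super_conjugators[OF assms] by blast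
  with True show ?thesis by (simp only: ultra_conjugators_def mem_Collect_eq simp_thms)
qed (simp add: ultra_conjugators_def)

lemma ultra_conjugators_subset: "ultra_conjugators f \<subseteq> super_conjugators f"
  by (auto simp: ultra_conjugators_def)

lemma ultra_conjugators_carrier: "x \<in> ultra_conjugators f \<Longrightarrow> x \<in> carrier G"
  using ultra_conjugators_subset super_conjugators_carrier by blast

text \<open>
  Let \<open>\<Psi>\<close> be the transport and \<open>\<Psi>\<^sup>k x = z \<otimes> x\<close>, \<open>\<Psi>\<^sup>k y = w \<otimes> y\<close> with \<open>z\<close>, \<open>w\<close> centralizing \<open>f\<close>. Then
  \<open>T = inv z \<otimes> \<Psi>\<^sup>k\<close> fixes \<open>x\<close>, hence preserves the finite intervals \<open>[x \<otimes> D (- b), x \<otimes> D b]\<close>; it is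
  injective on the centralizer coset of \<open>y\<close>, so \<open>y\<close> and therefore \<open>x \<triangle> y\<close> are periodic under \<open>T\<close>.
\<close>

lemma ultra_conjugators_meet:
  assumes f: "f \<in> carrier G" and x: "x \<in> ultra_conjugators f" and y: "y \<in> ultra_conjugators f"
  shows "x \<triangle> y \<in> ultra_conjugators f"
proof -
  define \<Psi> where "\<Psi> = transport f (summit_inf f)"
  define Z where "Z = {z \<in> carrier G. z \<otimes> f = f \<otimes> z}"
  have xG: "x \<in> carrier G" and yG: "y \<in> carrier G" using x y ultra_conjugators_carrier by auto
  note G = f xG yG
  have \<Psi>G [simp]: "(\<Psi> ^^ n) u \<in> carrier G" if "u \<in> carrier G" for n u
    using that f by (simp add: \<Psi>_def)
  have Z_mult: "a \<otimes> b \<in> Z" if "a \<in> Z" "b \<in> Z" for a b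
    using that f unfolding Z_def by (simp add: m_assoc) (simp flip: m_assoc)
  have Z_inv: "inv a \<in> Z" if "a \<in> Z" for a
    using that f commute_inv[of f a] unfolding Z_def by simp
  have ZG: "a \<in> carrier G" if "a \<in> Z" for a using that by (simp add: Z_def)
  have Z_cj: "cj (a \<otimes> u) f = cj u f" if "a \<in> Z" "u \<in> carrier G" for a u
    using that f by (subst cj_eq_iff) (auto simp: Z_def m_assoc)
  have \<Psi>_Z: "(\<Psi> ^^ n) (a \<otimes> u) = a \<otimes> (\<Psi> ^^ n) u" if "a \<in> Z" "u \<in> carrier G" for n a u
    using that f by (simp add: Z_def \<Psi>_def funpow_transport_commute)
  obtain k1 k2 where k12: "k1 \<ge> 1" "(cycling ^^ k1) (cj x f) = cj x f"
    "k2 \<ge> 1" "(cycling ^^ k2) (cj y f) = cj y f"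
    using x y by (auto simp: ultra_conjugators_def)
  define k where "k = k1 * k2"
  have k: "k \<ge> 1" using k12 by (simp add: k_def)
  have "(cycling ^^ k) (cj x f) = cj x f" "(cycling ^^ k) (cj y f) = cj y f"
    using funpow_mult_fixed[OF k12(2), of k2] funpow_mult_fixed[OF k12(4), of k1]
    by (auto simp: k_def mult.commute)
  then have cjk: "cj ((\<Psi> ^^ k) x) f = cj x f" "cj ((\<Psi> ^^ k) y) f = cj y f"
    using funpow_transport_super_conjugators[OF f subsetD[OF ultra_conjugators_subset x], of k]
      funpow_transport_super_conjugators[OF f subsetD[OF ultra_conjugators_subset y], of k] by (simp_all add: \<Psi>_def)
  define z where "z = (\<Psi> ^^ k) x \<otimes> inv x"
  define w where "w = (\<Psi> ^^ k) y \<otimes> inv y"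
  have zw: "z \<in> Z" "w \<in> Z"
    using cjk G by (auto simp: z_def w_def Z_def cj_eq_iff)
  have zx: "(\<Psi> ^^ k) x = z \<otimes> x" and wy: "(\<Psi> ^^ k) y = w \<otimes> y"
    using G by (auto simp: z_def w_def m_assoc)
  define T where "T u = inv z \<otimes> (\<Psi> ^^ k) u" for u
  have TG: "T u \<in> carrier G" if "u \<in> carrier G" for u
    using that zw ZG by (simp add: T_def)
  have TnG: "(T ^^ n) u \<in> carrier G" if "u \<in> carrier G" for n u
    using that TG by (intro funpow_closed[of "carrier G" T]) auto
  have T_meet: "T (u \<triangle> v) = T u \<triangle> T v" if "u \<in> carrier G" "v \<in> carrier G" for u v
    using that zw ZG f by (simp add: T_def \<Psi>_def funpow_transport_meet meet_mult_left)
  have T_mono: "T u \<preceq> T v" if "u \<preceq> v" "u \<in> carrier G" "v \<in> carrier G" for u v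
  proof -
    have "u \<triangle> v = u" using that by (intro meet_eqI) (auto intro: le_trans)
    then have "T u = T u \<triangle> T v" using T_meet[OF that(2,3)] by simp
    then show ?thesis using that TG by (metis meet_le2)
  qed
  have Tx: "T (x \<otimes> D j) = x \<otimes> D j" for j
  proof -
    have "T (x \<otimes> D j) = inv z \<otimes> ((\<Psi> ^^ k) x \<otimes> D j)"
      using G by (simp add: T_def \<Psi>_def funpow_transport_mult_D)
    then show ?thesis using G zw ZG by (simp add: zx m_assoc)
  qed
  obtain b where b: "D (- b) \<preceq> inv x \<otimes> y" "inv x \<otimes> y \<preceq> D b"
    using bounded_D[of "inv x \<otimes> y"] G by auto
  then have yb: "x \<otimes> D (- b) \<preceq> y" "y \<preceq> x \<otimes> D b"
    using G le_mult_left_iff[of x "D (- b)" "inv x \<otimes> y"] le_mult_left_iff[of x "inv x \<otimes> y" "D b"]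
    by auto
  define Q where "Q = {u \<in> carrier G. x \<otimes> D (- b) \<preceq> u \<and> u \<preceq> x \<otimes> D b} \<inter> (\<lambda>a. a \<otimes> y) ` Z"
  have "finite Q" unfolding Q_def using G by (intro finite_Int disjI1 finite_interval) auto
  have TZ: "T (a \<otimes> y) = inv z \<otimes> a \<otimes> w \<otimes> y" if "a \<in> Z" for a
    using that zw ZG G by (simp add: T_def \<Psi>_Z wy m_assoc)
  have TQ: "T u \<in> Q" if u: "u \<in> Q" for u
  proof -
    obtain a where a: "a \<in> Z" "u = a \<otimes> y" using u by (auto simp: Q_def)
    have "inv z \<otimes> a \<otimes> w \<in> Z" by (intro Z_mult Z_inv zw a)
    moreover have "T u = inv z \<otimes> a \<otimes> w \<otimes> y" using a TZ by simp
    ultimately have "T u \<in> (\<lambda>a. a \<otimes> y) ` Z" by (rule image_eqI[rotated])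
    moreover have "x \<otimes> D (- b) \<preceq> T u" "T u \<preceq> x \<otimes> D b"
      using u T_mono[of "x \<otimes> D (- b)" u] T_mono[of u "x \<otimes> D b"] G by (auto simp: Q_def Tx)
    ultimately show ?thesis using TG u by (auto simp: Q_def)
  qed
  have "inj_on T Q"
  proof (rule inj_onI)
    fix u v assume uv: "u \<in> Q" "v \<in> Q" "T u = T v"
    then obtain a c where ac: "a \<in> Z" "u = a \<otimes> y" "c \<in> Z" "v = c \<otimes> y" by (auto simp: Q_def)
    with uv(3) have "inv z \<otimes> a \<otimes> w \<otimes> y = inv z \<otimes> c \<otimes> w \<otimes> y" by (simp add: TZ)
    then have "a = c" using ac zw ZG G by simp
    with ac show "u = v" by simp
  qed
  moreover have "y \<in> Q"
  proof -
    have "\<one> \<in> Z" using f by (simp add: Z_def)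
    then have "y \<in> (\<lambda>a. a \<otimes> y) ` Z" using G by (intro image_eqI[of _ _ \<one>]) auto
    then show ?thesis using yb G by (simp add: Q_def)
  qed
  ultimately obtain m where m: "m \<ge> 1" "(T ^^ m) y = y"
    using finite_inj_on_periodic[of Q T y, OF \<open>finite Q\<close> TQ] by blast
  have "(T ^^ n) (x \<triangle> y) = (T ^^ n) x \<triangle> (T ^^ n) y" for n
    using G TnG by (induction n) (auto simp: T_meet)
  moreover have "(T ^^ n) x = x" for n
    using Tx[of 0] G by (induction n) auto
  ultimately have fixed: "(T ^^ m) (x \<triangle> y) = x \<triangle> y" using m by simp
  \<comment> \<open>Iterates of \<open>T\<close> and of \<open>\<Psi> ^^ k\<close> differ by a left
    factor in the centralizer, which conjugation of \<open>f\<close> does not see. Hence a point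
    periodic under \<open>T\<close> yields a conjugate periodic under cycling.\<close>
  have "\<exists>a\<in>Z. (T ^^ n) u = a \<otimes> (\<Psi> ^^ (k * n)) u" if "u \<in> carrier G" for n u
  proof (induction n)
    case 0
    show ?case using that f by (intro bexI[of _ \<one>]) (auto simp: Z_def)
  next
    case (Suc n)
    then obtain a where a: "a \<in> Z" "(T ^^ n) u = a \<otimes> (\<Psi> ^^ (k * n)) u" by blast
    have "(T ^^ Suc n) u = inv z \<otimes> (\<Psi> ^^ k) (a \<otimes> (\<Psi> ^^ (k * n)) u)"
      using a by (simp add: T_def)
    also have "\<dots> = inv z \<otimes> a \<otimes> (\<Psi> ^^ k) ((\<Psi> ^^ (k * n)) u)"
      using a that zw ZG by (simp add: \<Psi>_Z m_assoc)
    also have "(\<Psi> ^^ k) ((\<Psi> ^^ (k * n)) u) = (\<Psi> ^^ (k * Suc n)) u"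
      by (simp add: funpow_add)
    finally have "(T ^^ Suc n) u = inv z \<otimes> a \<otimes> (\<Psi> ^^ (k * Suc n)) u" .
    moreover have "inv z \<otimes> a \<in> Z" by (intro Z_mult Z_inv zw a)
    ultimately show ?case by (rule bexI)
  qed
  from this[of "x \<triangle> y" m]
  obtain a where a: "a \<in> Z" "x \<triangle> y = a \<otimes> (\<Psi> ^^ (k * m)) (x \<triangle> y)"
    using fixed G by auto
  then have "cj ((\<Psi> ^^ (k * m)) (x \<triangle> y)) f = cj (x \<triangle> y) f"
    using Z_cj[of a "(\<Psi> ^^ (k * m)) (x \<triangle> y)"] G by simp
  moreover have "stable {f} (super_conjugators f)" using f by (intro super_conjugators_stable) auto
  then have "x \<triangle> y \<in> super_conjugators f"
    using subsetD[OF ultra_conjugators_subset x] subsetD[OF ultra_conjugators_subset y] by (simp add: stable_def)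
  moreover have "k * m \<ge> 1" using k m by simp
  ultimately show ?thesis
    unfolding ultra_conjugators_iff[OF f] \<Psi>_def by blast
qed

text \<open>Meets are the previous lemma. For the other moves, transport commutes with right
  multiplication by powers of \<Delta> and with left multiplication by centralizing elements, so the
  same period \<open>k\<close> works.\<close>

lemma ultra_conjugators_stable:
  assumes f: "f \<in> carrier G" and H: "H \<subseteq> carrier G" "\<And>h. h \<in> H \<Longrightarrow> h \<otimes> f = f \<otimes> h"
  shows "stable H (ultra_conjugators f)"
proof -
  have S: "stable H (super_conjugators f)" using assms by (rule super_conjugators_stable)
  have "x \<otimes> D j \<in> ultra_conjugators f" if x_ultra_conjugators: "x \<in> ultra_conjugators f" for x j
  proof -
    have x: "x \<in> super_conjugators f" "x \<in> carrier G" using x_ultra_conjugators ultra_conjugators_subset super_conjugators_carrier by auto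
    obtain k where k: "k \<ge> 1" "cj ((transport f (summit_inf f) ^^ k) x) f = cj x f"
      using x_ultra_conjugators unfolding ultra_conjugators_iff[OF f] by blast
    have "cj ((transport f (summit_inf f) ^^ k) (x \<otimes> D j)) f = cj (D j) (cj ((transport f (summit_inf f) ^^ k) x) f)"
      using f x by (simp add: funpow_transport_mult_D cj_cj)
    also have "\<dots> = cj (x \<otimes> D j) f" using k f x by (simp add: cj_cj)
    finally have "cj ((transport f (summit_inf f) ^^ k) (x \<otimes> D j)) f = cj (x \<otimes> D j) f" .
    moreover have "x \<otimes> D j \<in> super_conjugators f" using x S by (simp add: stable_def)
    ultimately show ?thesis using k(1) unfolding ultra_conjugators_iff[OF f] by blast
  qed
  moreover have "h \<otimes> x \<in> ultra_conjugators f" if x_ultra_conjugators: "x \<in> ultra_conjugators f" and "h \<in> H" for x h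
  proof -
    have x: "x \<in> super_conjugators f" "x \<in> carrier G" using x_ultra_conjugators ultra_conjugators_subset super_conjugators_carrier by auto
    have h: "h \<in> carrier G" "h \<otimes> f = f \<otimes> h" using \<open>h \<in> H\<close> H by auto
    have cj: "cj (h \<otimes> u) f = cj u f" if "u \<in> carrier G" for u
      using that f h by (subst cj_eq_iff) (auto simp: m_assoc)
    obtain k where k: "k \<ge> 1" "cj ((transport f (summit_inf f) ^^ k) x) f = cj x f"
      using x_ultra_conjugators unfolding ultra_conjugators_iff[OF f] by blast
    have "cj ((transport f (summit_inf f) ^^ k) (h \<otimes> x)) f = cj (h \<otimes> x) f"
      using f x h k by (simp add: funpow_transport_commute cj)
    moreover have "h \<otimes> x \<in> super_conjugators f" using x S \<open>h \<in> H\<close> by (simp add: stable_def)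
    ultimately show ?thesis using k(1) unfolding ultra_conjugators_iff[OF f] by blast
  qed
  ultimately show ?thesis
    using ultra_conjugators_meet[OF f] ultra_conjugators_carrier unfolding stable_def by blast
qed

text \<open>The conjugates lie in one interval between two powers of \<Delta>.\<close>

lemma finite_conj_super_conjugators:
  assumes "f \<in> carrier G"
  shows "finite ((\<lambda>x. cj x f) ` super_conjugators f)"
proof (rule finite_subset)
  show "(\<lambda>x. cj x f) ` super_conjugators f
    \<subseteq> {g \<in> carrier G. D (summit_inf f) \<preceq> g \<and> g \<preceq> D (- summit_inf (inv f))}"
    using assms by (auto simp: super_conjugators_def le_D_iff_inv inv_cj)
qed (intro finite_interval, auto)

text \<open>A conjugator \<open>z\<close> attaining the summit infimum satisfies
  \<open>z \<preceq> twist h k z\<close> with \<open>k = summit_inf h\<close>. Shifted below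
  \<open>x\<close> by a power of \<Delta>, it bounds the whole twist orbit of \<open>x\<close> from
  below, as \<open>inf_step\<close> requires.\<close>

lemma inf_step_summit:
  assumes h: "h \<in> H" "H \<subseteq> carrier G" and x: "x \<in> carrier G"
  shows "\<exists>y\<in>carrier G. D (summit_inf h) \<preceq> cj y h \<and> (\<forall>A. stable H A \<longrightarrow> x \<in> A \<longrightarrow> y \<in> A)"
proof -
  let ?k = "summit_inf h"
  have hG: "h \<in> carrier G" using h by auto
  obtain z where z: "z \<in> carrier G" "z \<preceq> twist h ?k z"
    using summit_inf_props(1)[OF hG] hG by (metis D_le_cj_iff D_le_iff_inf cj_closed order_refl)
  obtain c where c: "D (- c) \<preceq> inv z \<otimes> x" using bounded_D[of "inv z \<otimes> x"] z x by auto
  define l where "l = z \<otimes> D (- c)"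
  have l: "l \<in> carrier G" "l \<preceq> x" "l \<preceq> twist h ?k l"
    using z x c hG le_mult_left_iff[of z "D (- c)" "inv z \<otimes> x"] by (auto simp: l_def twist_D)
  have "l \<preceq> (twist h ?k ^^ i) x" for i
  proof (induction i)
    case (Suc i)
    then have "twist h ?k l \<preceq> (twist h ?k ^^ Suc i) x" using l x hG by simp
    with l show ?case using le_trans by blast
  qed (use l in simp)
  then show ?thesis using inf_step h x l by blast
qed

text \<open>Three phases: raise the infimum of the conjugate of \<open>h\<close>, raise that of the
  inverse, then transport until the cycling orbit in the finite super summit set repeats. The first
  bound survives the second phase because it defines a stable set, and the final \<open>y\<close>
  inherits every stable property of \<open>x\<close>.\<close>

lemma ultra_step:
  assumes H: "subgroup H G" and h: "h \<in> H" and x: "x \<in> carrier G"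
    and comm: "\<And>g. g \<in> H \<Longrightarrow> g \<otimes> h = h \<otimes> g"
  obtains y where "y \<in> ultra_conjugators h" "\<And>A. stable H A \<Longrightarrow> x \<in> A \<Longrightarrow> y \<in> A"
proof -
  have HG: "H \<subseteq> carrier G" using H by (rule subgroup.subset)
  then have hG: "h \<in> carrier G" using h by auto
  obtain u where u: "u \<in> carrier G" "D (summit_inf h) \<preceq> cj u h" "\<And>A. stable H A \<Longrightarrow> x \<in> A \<Longrightarrow> u \<in> A"
    using inf_step_summit[OF h HG x] by blast
  have inv_h: "inv h \<in> H" using H h by (rule subgroup.m_inv_closed)
  obtain v where v: "v \<in> carrier G" "D (summit_inf (inv h)) \<preceq> cj v (inv h)"
    "\<And>A. stable H A \<Longrightarrow> u \<in> A \<Longrightarrow> v \<in> A"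
    using inf_step_summit[OF inv_h HG u(1)] by blast
  have "stable H {x \<in> carrier G. D (summit_inf h) \<preceq> cj x h}"
    using hG HG comm by (rule stable_le_twist)
  from v(3)[OF this] u v have vS: "v \<in> super_conjugators h" by (simp add: super_conjugators_def)
  define s where "s n = (transport h (summit_inf h) ^^ n) v" for n
  have s: "s n \<in> super_conjugators h" "cj (s n) h = (cycling ^^ n) (cj v h)" for n
    using funpow_transport_super_conjugators[OF hG vS] by (auto simp: s_def)
  then have "(cycling ^^ n) (cj v h) \<in> (\<lambda>x. cj x h) ` super_conjugators h" for n by (metis imageI)
  then obtain i j where ij: "i < j" "(cycling ^^ i) (cj v h) = (cycling ^^ j) (cj v h)"
    by (rule finite_range_repeats[OF finite_conj_super_conjugators[OF hG]])
  have "cycling ^^ j = cycling ^^ (j - i) \<circ> cycling ^^ i"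
    using ij(1) by (simp flip: funpow_add)
  then have "(cycling ^^ (j - i)) (cj (s i) h) = cj (s i) h"
    using ij(2) s(2) by (metis comp_apply)
  moreover have "j - i \<ge> 1" using ij(1) by simp
  ultimately have "s i \<in> ultra_conjugators h" using s(1)[of i] unfolding ultra_conjugators_def by blast
  moreover have "s i \<in> A" if "stable H A" "x \<in> A" for A
  proof -
    have "s n \<in> A" for n
      using u(3) v(3) that stable_transport[OF that(1) h] by (induction n) (auto simp: s_def)
    then show ?thesis .
  qed
  ultimately show ?thesis using that by blast
qed

end

section \<open>The rank of an abelian subgroup\<close>

locale abelian_subgroup = nontrivial_garside_group +
  fixes H
  assumes H_subgroup: "subgroup H G"
    and H_comm: "\<And>g h. g \<in> H \<Longrightarrow> h \<in> H \<Longrightarrow> g \<otimes> h = h \<otimes> g"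
begin

lemma H_carrier [simp, intro]: "h \<in> H \<Longrightarrow> h \<in> carrier G"
  using H_subgroup subgroup.mem_carrier by fastforce

lemma H_mult: "g \<in> H \<Longrightarrow> h \<in> H \<Longrightarrow> g \<otimes> h \<in> H"
  and H_one: "\<one> \<in> H"
  using H_subgroup by (auto simp: subgroup.m_closed subgroup.one_closed)

lemma H_int_pow: "h \<in> H \<Longrightarrow> h [^] (k :: int) \<in> H"
  using H_subgroup subgroup_int_pow_closed by blast

lemma H_nat_pow: "h \<in> H \<Longrightarrow> h [^] (k :: nat) \<in> H"
  using H_int_pow[of h "int k"] by (simp add: int_pow_int)

section \<open>Exponent vectors and orbit coordinates\<close>

primrec monomial :: "(nat \<Rightarrow> 'a) \<Rightarrow> nat \<Rightarrow> (nat \<Rightarrow> int) \<Rightarrow> 'a"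
  where "monomial f 0 w = \<one>"
  | "monomial f (Suc n) w = monomial f n w \<otimes> f n [^] w n"

definition independent :: "(nat \<Rightarrow> 'a) \<Rightarrow> nat \<Rightarrow> bool"
  where "independent f n \<longleftrightarrow> (\<forall>w. monomial f n w = \<one> \<longrightarrow> (\<forall>i<n. w i = 0))"

context
  fixes f :: "nat \<Rightarrow> 'a"
  assumes f: "\<And>i. f i \<in> H"
begin

lemma monomial_H: "monomial f n w \<in> H"
  by (induction n) (auto simp: H_one f intro!: H_mult H_int_pow)

lemma monomial_closed [simp, intro]: "monomial f n w \<in> carrier G"
  using monomial_H by blast

lemma f_closed [simp, intro]: "f i \<in> carrier G"
  using f by blast

lemma monomial_add: "monomial f n (\<lambda>i. w i + v i) = monomial f n w \<otimes> monomial f n v"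
proof (induction n)
  case (Suc n)
  have comm: "f n [^] w n \<otimes> monomial f n v = monomial f n v \<otimes> f n [^] w n"
    using H_comm f H_int_pow monomial_H by blast
  have "monomial f (Suc n) (\<lambda>i. w i + v i)
    = monomial f n w \<otimes> (monomial f n v \<otimes> f n [^] w n) \<otimes> f n [^] v n"
    using Suc by (simp add: int_pow_mult m_assoc)
  also have "\<dots> = monomial f (Suc n) w \<otimes> monomial f (Suc n) v"
    by (simp add: m_assoc flip: comm)
  finally show ?case .
qed simp

lemma monomial_zero: "(\<And>i. i < n \<Longrightarrow> w i = 0) \<Longrightarrow> monomial f n w = \<one>"
  by (induction n) auto

lemma monomial_cong: "(\<And>i. i < n \<Longrightarrow> w i = v i) \<Longrightarrow> monomial f n w = monomial f n v"
  by (induction n) auto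

lemma monomial_uminus: "monomial f n (\<lambda>i. - w i) = inv (monomial f n w)"
proof -
  have "monomial f n (\<lambda>i. - w i) \<otimes> monomial f n w = \<one>"
    using monomial_add[of n "\<lambda>i. - w i" w] by (simp add: monomial_zero)
  then show ?thesis by (simp add: inv_equality)
qed

lemma monomial_diff: "monomial f n (\<lambda>i. w i - v i) = monomial f n w \<otimes> inv (monomial f n v)"
  using monomial_add[of n w "\<lambda>i. - v i"] by (simp add: monomial_uminus)

lemma monomial_scale: "monomial f n (\<lambda>i. int m * w i) = monomial f n w [^] m"
  by (induction m) (simp_all add: monomial_zero distrib_right monomial_add H_comm[OF monomial_H H_nat_pow[OF monomial_H]])

text \<open>The Lipschitz bound, in the l1 norm, needed for the interpolation in
  \<open>rank_bound\<close>.\<close>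

lemma monomial_le_D:
  assumes A: "\<And>i. i < n \<Longrightarrow> f i \<preceq> D A \<and> D (- A) \<preceq> f i"
  shows "monomial f n w \<preceq> D (A * (\<Sum>i<n. \<bar>w i\<bar>))"
  using A
proof (induction n)
  case (Suc n)
  have pow: "g [^] (k :: nat) \<preceq> D (A * int k)" if "g \<preceq> D A" "g \<in> carrier G" for g k
  proof (induction k)
    case (Suc k)
    from mult_le_D[OF Suc that(1)] that(2) show ?case by (simp add: algebra_simps)
  qed (use that in simp)
  have "f n [^] w n \<preceq> D (A * \<bar>w n\<bar>)"
  proof (cases "w n" rule: int_cases2)
    case (nonneg k)
    then show ?thesis using pow[of "f n" k] Suc(2)[of n] by (simp add: int_pow_int)
  next
    case (nonpos k)
    have "inv (f n) \<preceq> D A" using Suc(2)[of n] by (simp add: le_D_iff_inv)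
    then have "inv (f n) [^] k \<preceq> D (A * int k)" by (intro pow) auto
    then show ?thesis using nonpos by (simp add: int_pow_neg_int nat_pow_inv)
  qed
  with Suc show ?case
    using mult_le_D[of "monomial f n w" "A * (\<Sum>i<n. \<bar>w i\<bar>)"] by (simp add: distrib_left)
qed simp

text \<open>
  \<open>coords f n g\<close> is the position of \<open>g\<close> in its orbit under left multiplication by monomials, relative
  to a chosen representative of the orbit.
\<close>

definition orbit_rep :: "nat \<Rightarrow> 'a \<Rightarrow> 'a"
  where "orbit_rep n g = (SOME x. x \<in> range (\<lambda>w. monomial f n w \<otimes> g))"

definition coords :: "nat \<Rightarrow> 'a \<Rightarrow> nat \<Rightarrow> int"
  where "coords n g = (SOME w. g = monomial f n w \<otimes> orbit_rep n g)"

text \<open>Points of one orbit get the same representative, because the choice operator sees only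
  the orbit as a set; independence then makes the exponent vector unique, so the coordinates are
  equivariant.\<close>

lemma coords_monomial:
  assumes ind: "independent f n" and g: "g \<in> carrier G" and i: "i < n"
  shows "coords n (monomial f n v \<otimes> g) i = v i + coords n g i"
proof -
  have orbit: "range (\<lambda>w. monomial f n w \<otimes> (monomial f n v \<otimes> g)) = range (\<lambda>w. monomial f n w \<otimes> g)"
  proof (intro equalityI image_subsetI)
    fix w
    have "monomial f n w \<otimes> (monomial f n v \<otimes> g) = monomial f n (\<lambda>i. w i + v i) \<otimes> g"
      using g by (simp add: monomial_add m_assoc)
    then show "monomial f n w \<otimes> (monomial f n v \<otimes> g) \<in> range (\<lambda>w. monomial f n w \<otimes> g)" by blast
    have "monomial f n w \<otimes> g = monomial f n (\<lambda>i. w i - v i) \<otimes> (monomial f n v \<otimes> g)"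
      using g by (simp add: monomial_diff m_assoc)
    then show "monomial f n w \<otimes> g \<in> range (\<lambda>w. monomial f n w \<otimes> (monomial f n v \<otimes> g))" by blast
  qed
  have rep: "orbit_rep n (monomial f n v \<otimes> g) = orbit_rep n g"
    unfolding orbit_rep_def orbit ..
  have "orbit_rep n g \<in> range (\<lambda>w. monomial f n w \<otimes> g)"
    unfolding orbit_rep_def by (rule someI_ex) blast
  then obtain u where u: "orbit_rep n g = monomial f n u \<otimes> g" by blast
  have repG: "orbit_rep n g \<in> carrier G" using u g by simp
  have "g = monomial f n (\<lambda>i. - u i) \<otimes> orbit_rep n g"
    using u g by (simp add: monomial_uminus)
  then have 1: "g = monomial f n (coords n g) \<otimes> orbit_rep n g"
    unfolding coords_def by (rule someI[of "\<lambda>w. g = monomial f n w \<otimes> orbit_rep n g"])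
  have "monomial f n v \<otimes> g = monomial f n (\<lambda>i. v i + coords n g i) \<otimes> orbit_rep n (monomial f n v \<otimes> g)"
    unfolding rep using repG by (subst (1) 1) (simp add: monomial_add m_assoc)
  then have "monomial f n v \<otimes> g = monomial f n (coords n (monomial f n v \<otimes> g)) \<otimes> orbit_rep n (monomial f n v \<otimes> g)"
    unfolding coords_def[of n "monomial f n v \<otimes> g"]
    by (rule someI[of "\<lambda>w. monomial f n v \<otimes> g = monomial f n w \<otimes> orbit_rep n (monomial f n v \<otimes> g)"])
  then have "monomial f n (coords n (monomial f n v \<otimes> g)) \<otimes> orbit_rep n g
      = monomial f n (\<lambda>i. v i + coords n g i) \<otimes> orbit_rep n g"
    using \<open>monomial f n v \<otimes> g = monomial f n (\<lambda>i. v i + coords n g i) \<otimes> orbit_rep n (monomial f n v \<otimes> g)\<close>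
    by (simp only: rep)
  then have "monomial f n (coords n (monomial f n v \<otimes> g)) = monomial f n (\<lambda>i. v i + coords n g i)"
    using repG by simp
  then have "monomial f n (\<lambda>i. coords n (monomial f n v \<otimes> g) i - (v i + coords n g i)) = \<one>"
    by (simp add: monomial_diff)
  with ind i show ?thesis unfolding independent_def by fastforce
qed

end

lemma finite_glb:
  assumes "finite W" "W \<noteq> {}" "\<And>w. w \<in> W \<Longrightarrow> g w \<in> carrier G"
  shows "\<exists>l\<in>carrier G. \<forall>z\<in>carrier G. z \<preceq> l \<longleftrightarrow> (\<forall>w\<in>W. z \<preceq> g w)"
  using assms
proof (induction W rule: finite_ne_induct)
  case (singleton w)
  then show ?case by auto
next
  case (insert w W)
  then obtain l where l: "l \<in> carrier G" "\<forall>z\<in>carrier G. z \<preceq> l \<longleftrightarrow> (\<forall>w\<in>W. z \<preceq> g w)" by auto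
  then show ?case
    using insert(5)[of w] by (intro bexI[of _ "g w \<triangle> l"]) (auto simp: le_meet_iff)
qed

text \<open>
  Points of \<open>\<real>\<^sup>n\<close> are represented by \<open>v / q\<close> with \<open>v\<close> integral and \<open>q\<close> large, real powers of \<open>\<Delta>\<close> by
  the \<open>q\<close> roundings \<open>j \<mapsto> D ((j + r) div q)\<close> of \<open>\<Delta>\<^sup>r\<^sup>/\<^sup>q\<close>: the interpolation \<open>pt v\<close> is a monotone path in
  \<open>G\<close>, and \<open>\<phi> v\<close> is \<open>q\<close> times the mean coordinate vector along it. A change of \<open>v\<close> by one step alters
  \<open>pt v j\<close> only for \<open>j\<close> near the boundedly many jumps, so \<open>K\<close> does not depend on \<open>q\<close>.
\<close>

lemma rank_bound:
  assumes f: "\<And>i. f i \<in> H" and ind: "independent f n"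
  shows "n < card simples"
proof (rule ccontr)
  assume "\<not> n < card simples"
  then have n: "card simples \<le> n" by simp
  note mG [simp] = monomial_closed[of f, OF f]
  obtain A where A: "0 \<le> A" "\<And>i. i < n \<Longrightarrow> f i \<preceq> D A \<and> D (- A) \<preceq> f i"
    using bounded_D_finite[of "f ` {..<n}"] f by (metis H_carrier finite_imageI finite_lessThan imageI image_subsetI lessThan_iff)
  define c where "c = A * int n"
  have c: "0 \<le> c" using A by (simp add: c_def)
  \<comment> \<open>Independent of \<open>q\<close>. By \<open>near_cell\<close> below it contains
    all path points translated back to the origin cell, so \<open>M\<close> bounds the distance
    between path coordinates and the cell.\<close>
  define Bd where "Bd = {b \<in> carrier G. D (- (c + 2)) \<preceq> b \<and> b \<preceq> D (c + 2)}"
  have finBd: "finite Bd" unfolding Bd_def by (intro finite_interval) auto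
  define M where "M = Max (insert 0 ((\<lambda>(b, i). \<bar>coords f n b i\<bar>) ` (Bd \<times> {..<n})))"
  have M0: "0 \<le> M" unfolding M_def using finBd by (intro Max_ge) auto
  have M: "\<bar>coords f n b i\<bar> \<le> M" if "b \<in> Bd" "i < n" for b i
    unfolding M_def using finBd that by (intro Max_ge) (auto intro!: image_eqI[of _ _ "(b, i)"])
  \<comment> \<open>One more than the error \<open>M\<close>, so that the boundary conditions of
    Kuhn's lemma hold on the faces of the box.\<close>
  define R where "R = M + 1"
  define W where "W = {w :: nat \<Rightarrow> int. \<forall>i. (i \<in> {..<n} \<longrightarrow> w i \<in> {- R..R}) \<and> (i \<notin> {..<n} \<longrightarrow> w i = 0)}"
  have finW: "finite W" unfolding W_def by (intro finite_set_of_finite_funs) auto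
  \<comment> \<open>A finite set containing every coordinate vector needed. It does not depend on
    \<open>q\<close>, so \<open>t\<close> and \<open>\<delta>\<close> are fixed before
    \<open>q\<close> is chosen.\<close>
  define V where "V = {y :: nat \<Rightarrow> real. \<forall>i. (i \<in> {..<n} \<longrightarrow> y i \<in> real_of_int ` {- (R + M)..R + M})
    \<and> (i \<notin> {..<n} \<longrightarrow> y i = 0)}"
  have "finite V" unfolding V_def by (intro finite_set_of_finite_funs) auto
  then obtain t \<delta> :: real where t: "0 < t" "t < 1" "0 < \<delta>" and hyp: "\<And>S. S \<subseteq> V \<Longrightarrow> card S \<le> n \<Longrightarrow>
      \<exists>a b. (\<forall>y\<in>S. (\<Sum>i<n. a i * y i) = b) \<and>
      \<delta> * (\<Sum>i<n. \<bar>a i\<bar>) < \<bar>(\<Sum>i<n. a i * t ^ Suc i) - b\<bar>"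
    using generic_moment_point[of V n] by blast
  \<comment> \<open>The number of indices at which neighbouring paths can differ, times the largest
    change of a coordinate there. Then \<open>q\<close> is taken so large that
    \<open>K \<le> q * \<delta>\<close>; \<open>c \<le> q\<close> keeps the indices shifted by
    \<open>c\<close> in the range of \<open>near_cell\<close>.\<close>
  define K where "K = real (card Bd * nat (2 * c)) * real_of_int (2 * M + 1)"
  define q where "q = max 1 (max c \<lceil>K / \<delta>\<rceil>)"
  have q: "1 \<le> q" "c \<le> q" "\<lceil>K / \<delta>\<rceil> \<le> q" by (auto simp: q_def)
  have qK: "K \<le> real_of_int q * \<delta>"
  proof -
    have "K / \<delta> \<le> real_of_int q" using q(3) by linarith
    then show ?thesis using t(3) by (simp add: pos_divide_le_eq)
  qed
  define dst where "dst v w = (\<Sum>i<n. \<bar>v i - q * w i\<bar>)" for v w :: "nat \<Rightarrow> int"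
  \<comment> \<open>McShane's formula: the value at the site \<open>w\<close>, raised by
    \<open>A\<close> times the l1 distance from \<open>v / q\<close> to \<open>w\<close> and by
    \<open>j / q\<close>, rounded down. The extension \<open>pt v j\<close> is the meet over all
    sites.\<close>
  define E where "E v j w = monomial f n w \<otimes> D ((j + A * dst v w) div q)" for v j w
  have EG [simp]: "E v j w \<in> carrier G" for v j w by (simp add: E_def)
  have "(\<lambda>_. 0) \<in> W" using M0 by (simp add: W_def R_def)
  then have "W \<noteq> {}" by blast
  have "\<exists>l\<in>carrier G. \<forall>z\<in>carrier G. z \<preceq> l \<longleftrightarrow> (\<forall>w\<in>W. z \<preceq> E v j w)" for v j
    by (rule finite_glb[OF finW \<open>W \<noteq> {}\<close>]) simp
  then obtain pt where ptG [simp]: "\<And>v j. pt v j \<in> carrier G"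
    and pt: "\<And>v j z. z \<in> carrier G \<Longrightarrow> z \<preceq> pt v j \<longleftrightarrow> (\<forall>w\<in>W. z \<preceq> E v j w)" by metis
  have pt_E: "pt v j \<preceq> E v j w" if "w \<in> W" for v j w
    using pt[of "pt v j" v j] that by simp
  have E_mono: "E v j w \<preceq> E v' j' w" if "j + A * dst v w \<le> j' + A * dst v' w" for v v' j j' w
    unfolding E_def using that q(1) by (intro mult_D_mono zdiv_mono1) auto
  have pt_mono: "pt v j \<preceq> pt v' j'" if "\<And>w. w \<in> W \<Longrightarrow> j + A * dst v w \<le> j' + A * dst v' w" for v v' j j'
  proof -
    have "pt v j \<preceq> E v' j' w" if "w \<in> W" for w
      using le_trans[OF pt_E[OF that] E_mono] \<open>\<And>w. w \<in> W \<Longrightarrow> j + A * dst v w \<le> j' + A * dst v' w\<close> that by simp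
    then show ?thesis by (simp add: pt)
  qed
  \<comment> \<open>Advancing \<open>j\<close> by \<open>q\<close> multiplies each \<open>E\<close>
    by \<Delta>, so a full path spans at most one factor \<Delta>.\<close>
  have pt_period: "pt v q \<preceq> pt v 0 \<otimes> D 1" for v
  proof -
    have "pt v q \<otimes> D (- 1) \<preceq> E v 0 w" if "w \<in> W" for w
    proof -
      have "(q + A * dst v w) div q = (0 + A * dst v w) div q + 1" using q(1) by simp
      then have "E v q w = E v 0 w \<otimes> D 1" by (simp add: E_def m_assoc)
      with pt_E[OF that, of v q] show ?thesis by (simp add: le_mult_D_swap)
    qed
    then have "pt v q \<otimes> D (- 1) \<preceq> pt v 0" by (simp add: pt)
    then show ?thesis by (simp add: le_mult_D_swap)
  qed
  define cell where "cell v = (\<lambda>i. if i < n then v i div q else 0)" for v :: "nat \<Rightarrow> int"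
  define box where "box v \<longleftrightarrow> (\<forall>i<n. \<bar>v i\<bar> \<le> R * q)" for v :: "nat \<Rightarrow> int"
  have cellR: "\<bar>v i div q\<bar> \<le> R" if "box v" "i < n" for v i
  proof -
    have "- R * q \<le> v i" "v i \<le> R * q" using that unfolding box_def by (metis abs_le_iff minus_le_iff mult_minus_left)+
    then have "(- R * q) div q \<le> v i div q" "v i div q \<le> (R * q) div q"
      using q(1) by (intro zdiv_mono1; simp)+
    moreover have "(- R * q) div q = - R" "(R * q) div q = R" using q(1) by (simp_all only: nonzero_mult_div_cancel_right)
    ultimately show ?thesis by linarith
  qed
  have cellW: "cell v \<in> W" if "box v" for v
  proof -
    have "- R \<le> v i div q \<and> v i div q \<le> R" if "i < n" for i
      using cellR[OF \<open>box v\<close> that] by linarith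
    then show ?thesis by (simp add: W_def cell_def)
  qed
  have cell_near: "\<bar>v i - q * cell v i\<bar> \<le> q" if "i < n" for v i
  proof -
    have "v i - q * (v i div q) = v i mod q" by (simp add: minus_mult_div_eq_mod)
    moreover have "0 \<le> v i mod q" "v i mod q < q" using q(1) by auto
    ultimately show ?thesis using that by (simp add: cell_def)
  qed
  have cell_dst: "dst v (cell v) \<le> int n * q" for v
    using sum_bounded_above[of "{..<n}" "\<lambda>i. \<bar>v i - q * cell v i\<bar>" q] cell_near by (simp add: dst_def)
  \<comment> \<open>The site \<open>cell v\<close> gives the upper bound. For the lower one, the
    triangle inequality for \<open>dst\<close> and the Lipschitz bound put every site above the same
    element.\<close>
  have near_cell: "inv (monomial f n (cell v)) \<otimes> pt v j \<in> Bd" if v: "box v" and j: "- q \<le> j" "j < 2 * q" for v j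
  proof -
    let ?m = "monomial f n (cell v)"
    have "pt v j \<preceq> E v j (cell v)" using pt_E cellW v by blast
    also have "E v j (cell v) \<preceq> ?m \<otimes> D (c + 2)"
      unfolding E_def
    proof (intro mult_D_mono mG)
      have "j + A * dst v (cell v) \<le> (c + 2) * q"
        using mult_left_mono[OF cell_dst[of v] A(1)] j by (simp add: c_def algebra_simps)
      then have "(j + A * dst v (cell v)) div q \<le> ((c + 2) * q) div q"
        using q(1) by (intro zdiv_mono1) auto
      then show "(j + A * dst v (cell v)) div q \<le> c + 2" using q(1) by simp
    qed
    finally have 1: "inv ?m \<otimes> pt v j \<preceq> D (c + 2)"
      by (simp flip: le_mult_left_swap)
    have "?m \<otimes> D (- (c + 2)) \<preceq> E v j w" if w: "w \<in> W" for w
    proof -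
      let ?s = "\<Sum>i<n. \<bar>cell v i - w i\<bar>"
      have "q * ?s \<le> dst v w + dst v (cell v)"
      proof -
        have "q * \<bar>cell v i - w i\<bar> \<le> \<bar>v i - q * w i\<bar> + \<bar>v i - q * cell v i\<bar>" for i
        proof -
          have "q * \<bar>cell v i - w i\<bar> = \<bar>q * (cell v i - w i)\<bar>"
            using q(1) by (simp add: abs_mult)
          moreover have "q * (cell v i - w i) = (v i - q * w i) - (v i - q * cell v i)"
            by (simp add: algebra_simps)
          ultimately show ?thesis by linarith
        qed
        then show ?thesis unfolding dst_def sum_distrib_left sum.distrib[symmetric] by (intro sum_mono)
      qed
      then have "q * ?s \<le> dst v w + int n * q" using cell_dst[of v] by linarith
      then have "A * (q * ?s) \<le> A * (dst v w + int n * q)" using A(1) by (rule mult_left_mono)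
      then have "(A * ?s - (c + 1)) * q \<le> j + A * dst v w"
        using j by (simp add: c_def algebra_simps)
      then have "((A * ?s - (c + 1)) * q) div q \<le> (j + A * dst v w) div q"
        using q(1) by (intro zdiv_mono1) auto
      then have exp: "A * ?s - (c + 2) \<le> (j + A * dst v w) div q" using q(1) by simp
      have "?m = monomial f n w \<otimes> monomial f n (\<lambda>i. cell v i - w i)"
        using monomial_add[of f n w "\<lambda>i. cell v i - w i", OF f] by simp
      also have "\<dots> \<preceq> monomial f n w \<otimes> D (A * ?s)"
        using monomial_le_D[of f, OF f A(2)] by simp
      finally have "?m \<otimes> D (- (c + 2)) \<preceq> monomial f n w \<otimes> D (A * ?s) \<otimes> D (- (c + 2))"
        by simp
      also have "\<dots> = monomial f n w \<otimes> D (A * ?s - (c + 2))" by (simp add: m_assoc algebra_simps)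
      also have "\<dots> \<preceq> E v j w" unfolding E_def using exp by (intro mult_D_mono) auto
      finally show ?thesis by simp
    qed
    then have "?m \<otimes> D (- (c + 2)) \<preceq> pt v j" by (simp add: pt)
    then have "D (- (c + 2)) \<preceq> inv ?m \<otimes> pt v j" by (simp add: le_mult_left_swap)
    with 1 show ?thesis by (simp add: Bd_def)
  qed
  have coord: "\<bar>coords f n (pt v j) i - v i div q\<bar> \<le> M"
    if v: "box v" and j: "- q \<le> j" "j < 2 * q" and i: "i < n" for v j i
  proof -
    have "pt v j = monomial f n (cell v) \<otimes> (inv (monomial f n (cell v)) \<otimes> pt v j)" by simp
    then have "coords f n (pt v j) i = cell v i + coords f n (inv (monomial f n (cell v)) \<otimes> pt v j) i"
      using coords_monomial[of f n "inv (monomial f n (cell v)) \<otimes> pt v j" i "cell v", OF f ind _ i] by simp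
    with M[OF near_cell[OF v j] i] i show ?thesis by (simp add: cell_def)
  qed
  define \<phi> where "\<phi> v i = (\<Sum>j\<in>{0..<q}. real_of_int (coords f n (pt v j) i))" for v i
  have \<phi>_near: "\<bar>\<phi> v i - real_of_int (q * (v i div q))\<bar> \<le> real_of_int (q * M)" if "box v" "i < n" for v i
  proof -
    have "\<phi> v i - real_of_int (q * (v i div q)) = (\<Sum>j\<in>{0..<q}. real_of_int (coords f n (pt v j) i - v i div q))"
      using q(1) by (simp add: \<phi>_def sum_subtractf)
    also have "\<bar>\<dots>\<bar> \<le> (\<Sum>j\<in>{0..<q}. real_of_int M)"
    proof (rule order_trans[OF sum_abs sum_mono])
      fix j assume "j \<in> {0..<q}"
      then have "\<bar>coords f n (pt v j) i - v i div q\<bar> \<le> M" using that q(1) by (intro coord) auto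
      then show "\<bar>real_of_int (coords f n (pt v j) i - v i div q)\<bar> \<le> real_of_int M"
        by (metis of_int_abs of_int_le_iff)
    qed
    also have "\<dots> = real_of_int (q * M)" using q(1) by simp
    finally show ?thesis .
  qed
  have dst_near: "dst v w \<le> dst v' w + int n" if "\<forall>i<n. \<bar>v i - v' i\<bar> \<le> 1" for v v' w
  proof -
    have "dst v w \<le> (\<Sum>i<n. \<bar>v' i - q * w i\<bar> + 1)"
      unfolding dst_def
    proof (rule sum_mono)
      fix i assume "i \<in> {..<n}"
      then have "\<bar>v i - v' i\<bar> \<le> 1" using that by simp
      then show "\<bar>v i - q * w i\<bar> \<le> \<bar>v' i - q * w i\<bar> + 1" by linarith
    qed
    then show ?thesis by (simp add: dst_def sum.distrib)
  qed
  \<comment> \<open>A unit step in \<open>v\<close> shifts the path by at most \<open>c\<close>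
    indices, so the two paths agree at \<open>j\<close> unless the path of \<open>v\<close> changes
    between \<open>j - c\<close> and \<open>j + c\<close>.\<close>
  have \<phi>_lipschitz: "\<bar>\<phi> v i - \<phi> v' i\<bar> \<le> K"
    if v: "box v" "box v'" and vv': "\<forall>i<n. \<bar>v i - v' i\<bar> \<le> 1" and i: "i < n" for v v' i
  proof -
    have v'v: "\<forall>i<n. \<bar>v' i - v i\<bar> \<le> 1" using vv' by (simp add: abs_minus_commute)
    have le1: "pt v (j - c) \<preceq> pt v' j" for j
    proof (rule pt_mono)
      show "j - c + A * dst v w \<le> j + A * dst v' w" for w
        using mult_left_mono[OF dst_near[OF vv', of w] A(1)] by (simp add: c_def distrib_left)
    qed
    have le2: "pt v' j \<preceq> pt v (j + c)" for j
    proof (rule pt_mono)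
      show "j + A * dst v' w \<le> j + c + A * dst v w" for w
        using mult_left_mono[OF dst_near[OF v'v, of w] A(1)] by (simp add: c_def distrib_left)
    qed
    have mono: "pt v j \<preceq> pt v j'" if "j \<le> j'" for j j'
      using that by (intro pt_mono) simp
    define bad where "bad = {j \<in> {0..<q}. pt v (j - c) \<noteq> pt v (j + c)}"
    have eq: "pt v j = pt v' j" if "j \<in> {0..<q} - bad" for j
    proof -
      have e: "pt v (j - c) = pt v (j + c)" using that by (simp add: bad_def)
      have "pt v' j = pt v (j - c)" using le1[of j] le2[of j] e by (intro le_antisym) auto
      moreover have "pt v j = pt v (j - c)"
        using mono[of "j - c" j] mono[of j "j + c"] c e by (intro le_antisym) auto
      ultimately show ?thesis by simp
    qed
    have image: "pt v ` {- c..<q + c} \<subseteq> (\<lambda>b. monomial f n (cell v) \<otimes> b) ` Bd"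
    proof (rule image_subsetI)
      fix j assume "j \<in> {- c..<q + c}"
      then have "inv (monomial f n (cell v)) \<otimes> pt v j \<in> Bd" using q c v by (intro near_cell) auto
      moreover have "pt v j = monomial f n (cell v) \<otimes> (inv (monomial f n (cell v)) \<otimes> pt v j)" by simp
      ultimately show "pt v j \<in> (\<lambda>b. monomial f n (cell v) \<otimes> b) ` Bd" by (rule rev_image_eqI)
    qed
    have fin_image: "finite (pt v ` {- c..<q + c})" using finite_subset[OF image] finBd by simp
    have "card bad \<le> card (pt v ` {- c..<q + c}) * nat (2 * c)"
      unfolding bad_def
    proof (rule card_variation_window[OF _ fin_image c])
      fix i j k :: int assume "i \<le> j" "j \<le> k" "pt v i = pt v k"
      then show "pt v i = pt v j" using mono[of i j] mono[of j k] by (intro le_antisym) auto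
    qed
    also have "card (pt v ` {- c..<q + c}) \<le> card Bd"
      using card_mono[OF _ image] card_image_le[OF finBd, of "\<lambda>b. monomial f n (cell v) \<otimes> b"] finBd by simp
    finally have bad: "card bad \<le> card Bd * nat (2 * c)" by simp
    have "finite bad" by (rule finite_subset[of _ "{0..<q}"]) (auto simp: bad_def)
    let ?d = "\<lambda>j. real_of_int (coords f n (pt v j) i) - real_of_int (coords f n (pt v' j) i)"
    have "\<phi> v i - \<phi> v' i = (\<Sum>j\<in>{0..<q}. ?d j)" by (simp add: \<phi>_def sum_subtractf)
    also have "\<dots> = (\<Sum>j\<in>bad. ?d j)"
    proof (rule sum.mono_neutral_right)
      show "bad \<subseteq> {0..<q}" by (auto simp: bad_def)
      show "\<forall>j\<in>{0..<q} - bad. ?d j = 0"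
      proof
        fix j assume "j \<in> {0..<q} - bad"
        from eq[OF this] show "?d j = 0" by (simp only: diff_self)
      qed
    qed simp
    also have "\<bar>\<dots>\<bar> \<le> (\<Sum>j\<in>bad. real_of_int (2 * M + 1))"
    proof (rule order_trans[OF sum_abs sum_mono])
      fix j assume "j \<in> bad"
      then have j: "- q \<le> j" "j < 2 * q" using q(1) by (auto simp: bad_def)
      have "\<bar>v i div q - v' i div q\<bar> \<le> 1"
      proof -
        have "\<bar>v i - v' i\<bar> \<le> 1" using vv' i by blast
        then have "v i \<le> v' i + q" "v' i \<le> v i + q" using q(1) by linarith+
        then have "v i div q \<le> (v' i + q) div q" "v' i div q \<le> (v i + q) div q"
          using q(1) by (intro zdiv_mono1; simp)+
        then show ?thesis using q(1) by simp
      qed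
      then have "\<bar>coords f n (pt v j) i - coords f n (pt v' j) i\<bar> \<le> 2 * M + 1"
        using coord[OF v(1) j i] coord[OF v(2) j i] by linarith
      then show "\<bar>?d j\<bar> \<le> real_of_int (2 * M + 1)"
        by (metis of_int_abs of_int_diff of_int_le_iff)
    qed
    also have "\<dots> = real (card bad) * real_of_int (2 * M + 1)" by simp
    also have "\<dots> \<le> K"
      unfolding K_def
    proof (rule mult_right_mono)
      show "real (card bad) \<le> real (card Bd * nat (2 * c))" using bad by (simp only: of_nat_le_iff)
    qed (use M0 in simp)
    finally show ?thesis .
  qed
  \<comment> \<open>The target coordinates lie between 0 and \<open>q\<close>. On a face of the box
    \<open>\<phi>_near\<close> has error \<open>q * M\<close>, while the cell coordinate times
    \<open>q\<close> has absolute value \<open>q * M + q\<close>.\<close>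
  obtain v where v: "box v" "\<forall>i<n. \<bar>\<phi> v i - real_of_int q * t ^ Suc i\<bar> \<le> K"
  proof (rule kuhn_approximate_zero[of "R * q" n "\<lambda>i. real_of_int q * t ^ Suc i" \<phi> K])
    show "0 < R * q" using M0 q(1) by (simp add: R_def)
    have p: "0 < real_of_int q * t ^ Suc i" "real_of_int q * t ^ Suc i \<le> real_of_int q" for i
      using t(1,2) q(1) power_le_one[of t "Suc i"] by (auto simp: mult_le_cancel_left1)
    fix v :: "nat \<Rightarrow> int" and i
    assume b: "\<forall>j<n. \<bar>v j\<bar> \<le> R * q" and i: "i < n"
    then have near: "\<bar>\<phi> v i - real_of_int (q * (v i div q))\<bar> \<le> real_of_int (q * M)"
      using \<phi>_near by (simp add: box_def)
    show "real_of_int q * t ^ Suc i \<le> \<phi> v i" if "v i = R * q"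
    proof -
      have "q * (v i div q) = q * M + q" using that q(1) by (simp add: R_def algebra_simps)
      with near p[of i] show ?thesis by (simp only: of_int_add of_int_mult)
    qed
    show "\<phi> v i < real_of_int q * t ^ Suc i" if "v i = - (R * q)"
    proof -
      have div_eq: "v i div q = - R"
        using that q(1) nonzero_mult_div_cancel_right[of q "- R"] by simp
      have "q * (v i div q) = - (q * M + q)" unfolding div_eq by (simp add: R_def algebra_simps)
      with near p[of i] q(1) show ?thesis by (simp only: of_int_add of_int_mult of_int_minus)
    qed
  next
    fix v v' :: "nat \<Rightarrow> int" and i
    assume "\<forall>j<n. \<bar>v j\<bar> \<le> R * q" "\<forall>j<n. \<bar>v' j\<bar> \<le> R * q" "\<forall>j<n. \<bar>v j - v' j\<bar> \<le> 1" "i < n"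
    then show "\<bar>\<phi> v i - \<phi> v' i\<bar> \<le> K" using \<phi>_lipschitz by (simp add: box_def)
  qed (use that in \<open>auto simp: box_def\<close>)
  define vec where "vec g = (\<lambda>i. if i < n then real_of_int (coords f n g i) else 0)" for g
  \<comment> \<open>The path from \<open>pt v 0\<close> stays below
    \<open>pt v 0 \<otimes> \<Delta>\<close>, so \<open>S\<close> has at most
    \<open>card simples\<close> elements and lies on a hyperplane that \<open>t\<close>
    avoids.\<close>
  define S where "S = (\<lambda>j. vec (pt v j)) ` {0..<q}"
  have "S \<subseteq> V"
  proof -
    have "\<bar>coords f n (pt v j) i\<bar> \<le> R + M" if "j \<in> {0..<q}" "i < n" for i j
      using coord[OF v(1), of j i] cellR[OF v(1) that(2)] that q(1) by fastforce
    then have "coords f n (pt v j) i \<in> {- (R + M)..R + M}" if "j \<in> {0..<q}" "i < n" for i j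
      using that by (metis abs_le_iff atLeastAtMost_iff minus_le_iff)
    then show ?thesis unfolding S_def V_def vec_def by auto
  qed
  moreover have "card S \<le> n"
  proof -
    have "S \<subseteq> (\<lambda>s. vec (pt v 0 \<otimes> s)) ` simples"
    proof
      fix y assume "y \<in> S"
      then obtain j where j: "0 \<le> j" "j < q" "y = vec (pt v j)" by (auto simp: S_def)
      have "pt v 0 \<preceq> pt v j" "pt v j \<preceq> pt v q" using j by (intro pt_mono; simp)+
      then have "pt v 0 \<preceq> pt v j" "pt v j \<preceq> pt v 0 \<otimes> D 1" using le_trans[OF _ pt_period] by auto
      then have "inv (pt v 0) \<otimes> pt v j \<in> simples"
        unfolding simples_iff by (simp add: le_iff D_1) (simp add: inv_mult_group m_assoc)
      moreover have "y = vec (pt v 0 \<otimes> (inv (pt v 0) \<otimes> pt v j))" using j by simp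
      ultimately show "y \<in> (\<lambda>s. vec (pt v 0 \<otimes> s)) ` simples" by (rule rev_image_eqI)
    qed
    then have "card S \<le> card simples"
      by (rule surj_card_le[OF finite_simples])
    with n show ?thesis by linarith
  qed
  ultimately obtain a b where ab: "\<forall>y\<in>S. (\<Sum>i<n. a i * y i) = b"
    "\<delta> * (\<Sum>i<n. \<bar>a i\<bar>) < \<bar>(\<Sum>i<n. a i * t ^ Suc i) - b\<bar>"
    using hyp by blast
  \<comment> \<open>\<open>\<phi> v / q\<close> is a mean of points of \<open>S\<close>, hence on
    their hyperplane, yet it is within \<open>K / q \<le> \<delta>\<close> of the moment point in
    every coordinate. This contradicts the margin.\<close>
  have "(\<Sum>i<n. a i * \<phi> v i) = (\<Sum>j\<in>{0..<q}. \<Sum>i<n. a i * vec (pt v j) i)"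
    unfolding \<phi>_def sum_distrib_left by (subst sum.swap) (simp add: vec_def)
  also have "\<dots> = (\<Sum>j\<in>{0..<q}. b)" using ab(1) by (intro sum.cong) (auto simp: S_def)
  also have "\<dots> = real_of_int q * b" using q(1) by simp
  finally have a\<phi>: "(\<Sum>i<n. a i * \<phi> v i) = real_of_int q * b" .
  have "real_of_int q * \<bar>(\<Sum>i<n. a i * t ^ Suc i) - b\<bar> = \<bar>(\<Sum>i<n. a i * (real_of_int q * t ^ Suc i - \<phi> v i))\<bar>"
  proof -
    have "(\<Sum>i<n. a i * (real_of_int q * t ^ Suc i - \<phi> v i)) = real_of_int q * ((\<Sum>i<n. a i * t ^ Suc i) - b)"
      using a\<phi> by (simp add: right_diff_distrib sum_subtractf sum_distrib_left mult_ac)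
    then show ?thesis using q(1) by (simp add: abs_mult)
  qed
  also have "\<dots> \<le> (\<Sum>i<n. \<bar>a i\<bar> * K)"
  proof (rule order_trans[OF sum_abs sum_mono])
    fix i assume "i \<in> {..<n}"
    then have "\<bar>real_of_int q * t ^ Suc i - \<phi> v i\<bar> \<le> K" using v(2) by (simp add: abs_minus_commute)
    then show "\<bar>a i * (real_of_int q * t ^ Suc i - \<phi> v i)\<bar> \<le> \<bar>a i\<bar> * K"
      by (simp add: abs_mult mult_left_mono)
  qed
  also have "\<dots> \<le> (\<Sum>i<n. \<bar>a i\<bar>) * (real_of_int q * \<delta>)"
    unfolding sum_distrib_right using qK by (intro sum_mono mult_left_mono) auto
  also have "\<dots> = real_of_int q * (\<delta> * (\<Sum>i<n. \<bar>a i\<bar>))" by (simp add: mult_ac)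
  also have "\<dots> < real_of_int q * \<bar>(\<Sum>i<n. a i * t ^ Suc i) - b\<bar>"
    using ab(2) q(1) by (intro mult_strict_left_mono) auto
  finally show False by simp
qed

end

section \<open>Simultaneous ultra summit conjugation\<close>

context nontrivial_garside_group
begin

text \<open>The hypothesis says \<open>\<one> \<preceq> (twist h k ^^ m) \<one>\<close>. Hence the
  whole twist orbit of 1 is bounded below by a bound for its first \<open>m\<close> terms, and
  \<open>inf_step\<close> applies at 1.\<close>

lemma summit_inf_ge:
  assumes h: "h \<in> carrier G" and m: "m \<ge> 1" and pow: "D (int m * k) \<preceq> h [^] m"
  shows "k \<le> summit_inf h"
proof -
  let ?T = "twist h k"
  have T1: "\<one> \<preceq> (?T ^^ m) \<one>"
    using h pow le_mult_D_swap[of \<one> "h [^] m" "- (int m * k)"] by (simp add: funpow_twist)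
  have mono: "(?T ^^ i) x \<preceq> (?T ^^ i) y" if "x \<preceq> y" "x \<in> carrier G" "y \<in> carrier G" for i x y
    using that h by (induction i) auto
  obtain c where c: "\<And>g. g \<in> (\<lambda>i. (?T ^^ i) \<one>) ` {..<m} \<Longrightarrow> D (- c) \<preceq> g \<and> g \<preceq> D c"
    using bounded_D_finite[of "(\<lambda>i. (?T ^^ i) \<one>) ` {..<m}"] h by (metis finite_imageI finite_lessThan funpow_twist_closed image_subsetI one_closed)
  have "D (- c) \<preceq> (?T ^^ i) \<one>" for i
  proof (induction i rule: less_induct)
    case (less i)
    show ?case
    proof (cases "i < m")
      case True
      then show ?thesis using c by blast
    next
      case False
      then have "?T ^^ i = ?T ^^ (i - m) \<circ> ?T ^^ m" by (simp flip: funpow_add)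
      then have "(?T ^^ (i - m)) \<one> \<preceq> (?T ^^ i) \<one>"
        using mono[OF T1] h by simp
      moreover have "D (- c) \<preceq> (?T ^^ (i - m)) \<one>" using less[of "i - m"] False m by simp
      ultimately show ?thesis using le_trans by blast
    qed
  qed
  then obtain y where "y \<in> carrier G" "D k \<preceq> cj y h"
    using inf_step[of h "{h}" \<one> "D (- c)" k] h by auto
  then show ?thesis
    using h summit_inf_props(2)[OF h] by (meson D_le_iff_inf cj_closed order_trans)
qed

end

context abelian_subgroup
begin

lemma H_ultra_conjugators_stable: "h \<in> H \<Longrightarrow> stable H (ultra_conjugators h)"
  using H_comm by (intro ultra_conjugators_stable) auto

lemma H_ultra_step:
  assumes "h \<in> H" "x \<in> carrier G"
  obtains y where "y \<in> ultra_conjugators h" "\<And>g. g \<in> H \<Longrightarrow> x \<in> ultra_conjugators g \<Longrightarrow> y \<in> ultra_conjugators g"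
  using ultra_step[OF H_subgroup assms] H_comm assms(1) H_ultra_conjugators_stable by metis

lemma finite_ultra:
  assumes "finite F" "F \<subseteq> H"
  shows "\<exists>y\<in>carrier G. \<forall>h\<in>F. y \<in> ultra_conjugators h"
  using assms
proof (induction F)
  case (insert h F)
  then obtain x where x: "x \<in> carrier G" "\<forall>h\<in>F. x \<in> ultra_conjugators h" by auto
  obtain y where y: "y \<in> ultra_conjugators h" "\<And>g. g \<in> H \<Longrightarrow> x \<in> ultra_conjugators g \<Longrightarrow> y \<in> ultra_conjugators g"
    using H_ultra_step[of h x] insert x by auto
  then show ?case
    using ultra_conjugators_carrier[OF y(1)] x insert(4) by (intro bexI[of _ y]) auto
qed auto

section \<open>From bounded rank to finite generation\<close>

lemma monomial_cong_base:
  "(\<And>i. i < n \<Longrightarrow> f i = f' i) \<Longrightarrow> monomial f n w = monomial f' n w"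
  by (induction n) auto

text \<open>\<open>rank_bound\<close> provides a largest independent family. Appending
  \<open>h\<close> creates a relation, whose exponent at \<open>h\<close> is nonzero since the
  family itself is independent.\<close>

lemma maximal_independent:
  obtains f n where "\<And>i. f i \<in> H" "independent f n"
    "\<And>h. h \<in> H \<Longrightarrow> \<exists>m a. m \<ge> 1 \<and> h [^] (m :: nat) = monomial f n a"
proof -
  define ranks where "ranks = {n. \<exists>f. (\<forall>i. f i \<in> H) \<and> independent f n}"
  have fin: "finite ranks"
    by (rule finite_subset[of _ "{..<card simples}"]) (auto simp: ranks_def intro: rank_bound)
  have "0 \<in> ranks" using H_one by (auto simp: ranks_def independent_def)
  then have "Max ranks \<in> ranks" using fin by (intro Max_in) auto
  then obtain f where f: "\<And>i. f i \<in> H" "independent f (Max ranks)" by (auto simp: ranks_def)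
  define n where "n = Max ranks"
  have "Suc n \<notin> ranks" using Max_ge[OF fin, of "Suc n"] by (auto simp: n_def)
  have "\<exists>m a. m \<ge> 1 \<and> h [^] (m :: nat) = monomial f n a" if h: "h \<in> H" for h
  proof -
    let ?f = "f(n := h)"
    have "\<forall>i. ?f i \<in> H" using f(1) h by simp
    then have "\<not> independent ?f (Suc n)" using \<open>Suc n \<notin> ranks\<close> unfolding ranks_def by blast
    then obtain w i where w: "monomial ?f (Suc n) w = \<one>" "i < Suc n" "w i \<noteq> 0"
      by (auto simp: independent_def)
    have "monomial ?f n w = monomial f n w" by (rule monomial_cong_base) simp
    then have eq: "monomial f n w \<otimes> h [^] w n = \<one>" using w(1) by simp
    have "w n \<noteq> 0"
    proof
      assume "w n = 0"
      then have "monomial f n w = \<one>" using eq monomial_closed[of f, OF f(1)] by simp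
      then have "\<forall>i<n. w i = 0" using f(2) by (simp add: independent_def n_def)
      with w \<open>w n = 0\<close> show False using less_Suc_eq by auto
    qed
    show ?thesis
    proof (cases "w n" rule: int_cases2)
      case (nonneg m)
      then have "inv (h [^] m) = monomial f n w"
        using eq h monomial_closed[of f, OF f(1)] by (intro inv_equality) (auto simp: int_pow_int)
      then have "h [^] m = monomial f n (\<lambda>i. - w i)"
        using h inv_inv[of "h [^] m"] by (simp add: monomial_uminus[of f, OF f(1)])
      then show ?thesis using nonneg \<open>w n \<noteq> 0\<close> by (intro exI[of _ m] exI[of _ "\<lambda>i. - w i"]) auto
    next
      case (nonpos m)
      then have "monomial f n w \<otimes> inv (h [^] m) = \<one>" using eq h by (simp add: int_pow_neg_int)
      then have "h [^] m = monomial f n w"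
        using h monomial_closed[of f, OF f(1)] by (metis H_carrier inv_closed inv_equality inv_inv nat_pow_closed)
      then show ?thesis using nonpos \<open>w n \<noteq> 0\<close> by (intro exI[of _ m] exI[of _ w]) auto
    qed
  qed
  with that f n_def show ?thesis by blast
qed

text \<open>These are the elements, torsion included, whose rational exponent vectors lie in
  [0,1)^n. By \<open>summit_inf_ge\<close> their summit infima, and those of their inverses, are at
  least \<open>- k\<close>. Any finite subset can be conjugated simultaneously into super summit
  elements, hence into the finite interval \<open>I\<close>, which does not depend on the subset; so
  its size is bounded by \<open>card I\<close>.\<close>

lemma finite_fundamental_domain:
  assumes f: "\<And>i. f i \<in> H"
  shows "finite {h \<in> H. \<exists>m\<ge>1. \<exists>b. (\<forall>i<n. 0 \<le> b i \<and> b i < int m) \<and> h [^] (m :: nat) = monomial f n b}"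
    (is "finite ?B")
proof -
  obtain A where A: "0 \<le> A" "\<And>i. i < n \<Longrightarrow> f i \<preceq> D A \<and> D (- A) \<preceq> f i"
    using bounded_D_finite[of "f ` {..<n}"] f by (metis H_carrier finite_imageI finite_lessThan imageI image_subsetI lessThan_iff)
  define k where "k = A * int n"
  define I where "I = {g \<in> carrier G. D (- k) \<preceq> g \<and> g \<preceq> D k}"
  have finI: "finite I" unfolding I_def by (intro finite_interval) auto
  have summit: "- k \<le> summit_inf h \<and> - k \<le> summit_inf (inv h)" if h_B: "h \<in> ?B" for h
  proof -
    obtain m b where m: "m \<ge> 1" "\<forall>i<n. 0 \<le> b i \<and> b i < int m" "h [^] m = monomial f n b" and h: "h \<in> H"
      using h_B by blast
    have le: "monomial f n w \<preceq> D (k * int m)" if "\<forall>i<n. \<bar>w i\<bar> \<le> int m" for w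
    proof -
      have "(\<Sum>i<n. \<bar>w i\<bar>) \<le> int n * int m"
        using sum_bounded_above[of "{..<n}" "\<lambda>i. \<bar>w i\<bar>" "int m"] that by simp
      then have "A * (\<Sum>i<n. \<bar>w i\<bar>) \<le> k * int m"
        using mult_left_mono[OF _ A(1)] by (simp add: k_def mult.assoc)
      then show ?thesis using le_trans[OF monomial_le_D[of f, OF f A(2)] D_mono] monomial_closed[of f, OF f] by blast
    qed
    have "monomial f n b \<preceq> D (k * int m)" "monomial f n (\<lambda>i. - b i) \<preceq> D (k * int m)"
      using m(2) by (auto intro!: le)
    then have "D (int m * - k) \<preceq> h [^] m" "D (int m * - k) \<preceq> inv (h [^] m)"
      using monomial_closed[of f, OF f]
      by (auto simp: m(3) monomial_uminus[of f, OF f] le_D_iff_inv mult.commute)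
    then show ?thesis
      using summit_inf_ge[of h m "- k"] summit_inf_ge[of "inv h" m "- k"] h m(1) by (simp add: nat_pow_inv)
  qed
  have "card B' \<le> card I" if B': "B' \<subseteq> ?B" "finite B'" for B'
  proof -
    have "B' \<subseteq> H" using B' by blast
    then obtain y where y: "y \<in> carrier G" "\<forall>h\<in>B'. y \<in> ultra_conjugators h" using finite_ultra[OF B'(2)] by blast
    have "inj_on (cj y) B'"
      using y(1) \<open>B' \<subseteq> H\<close> by (intro inj_onI) (auto simp: cj_def subset_iff)
    moreover have "cj y ` B' \<subseteq> I"
    proof (rule image_subsetI)
      fix h assume h: "h \<in> B'"
      then have hG: "h \<in> carrier G" using \<open>B' \<subseteq> H\<close> by blast
      have "y \<in> super_conjugators h" using y h ultra_conjugators_subset by blast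
      then have "D (summit_inf h) \<preceq> cj y h" "D (summit_inf (inv h)) \<preceq> inv (cj y h)"
        using hG y(1) by (auto simp: super_conjugators_def inv_cj)
      moreover have "D (- k) \<preceq> D (summit_inf h)" "D (- k) \<preceq> D (summit_inf (inv h))"
        using summit[of h] h B'(1) by (auto intro!: D_mono)
      ultimately have "D (- k) \<preceq> cj y h" "D (- k) \<preceq> inv (cj y h)" using le_trans by blast+
      then show "cj y h \<in> I" using hG y(1) by (simp add: I_def le_D_iff_inv)
    qed
    ultimately show ?thesis using finI card_inj_on_le by blast
  qed
  then show ?thesis using finite_if_finite_subsets_card_bdd by blast
qed

text \<open>This is finite generation of \<open>H\<close>, in the form in which it is used.\<close>

lemma finite_determining_set:
  obtains F where "finite F" "F \<subseteq> H"
    "\<And>x y. \<lbrakk>x \<in> carrier G; y \<in> carrier G; \<forall>g\<in>F. cj x g = cj y g\<rbrakk> \<Longrightarrow> \<forall>h\<in>H. cj x h = cj y h"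
proof -
  obtain f n where f: "\<And>i. f i \<in> H" "independent f n"
    and root: "\<And>h. h \<in> H \<Longrightarrow> \<exists>m a. m \<ge> 1 \<and> h [^] (m :: nat) = monomial f n a"
    using maximal_independent by blast
  define B where "B = {h \<in> H. \<exists>m\<ge>1. \<exists>b. (\<forall>i<n. 0 \<le> b i \<and> b i < int m) \<and> h [^] (m :: nat) = monomial f n b}"
  have "finite B" unfolding B_def using f(1) by (rule finite_fundamental_domain)
  have decomp: "\<exists>b\<in>B. \<exists>w. h = monomial f n w \<otimes> b" if h: "h \<in> H" for h
  proof -
    obtain m a where m: "m \<ge> 1" "h [^] (m :: nat) = monomial f n a" using root[OF h] by blast
    \<comment> \<open>The integral part of the rational exponent vector \<open>a / m\<close> of
      \<open>h\<close>; the remainder \<open>b\<close> falls into \<open>B\<close>.\<close>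
    define w where "w i = a i div int m" for i
    define b where "b = monomial f n (\<lambda>i. - w i) \<otimes> h"
    have bH: "b \<in> H" unfolding b_def using h f(1) by (intro H_mult monomial_H)
    have "b [^] m = monomial f n (\<lambda>i. - w i) [^] m \<otimes> h [^] m"
      unfolding b_def using h f(1) H_comm[OF monomial_H[of f, OF f(1)] h] monomial_closed[of f, OF f(1)]
      by (intro pow_mult_distrib) auto
    also have "\<dots> = monomial f n (\<lambda>i. int m * (- w i) + a i)"
      unfolding m(2) monomial_add[of f, OF f(1)] monomial_scale[of f, OF f(1)] ..
    also have "\<dots> = monomial f n (\<lambda>i. a i mod int m)"
      by (rule monomial_cong) (auto simp: f w_def minus_mult_div_eq_mod[symmetric])
    finally have pow: "b [^] m = monomial f n (\<lambda>i. a i mod int m)" .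
    have range: "\<forall>i<n. 0 \<le> a i mod int m \<and> a i mod int m < int m" using m(1) by simp
    have "b \<in> B"
      unfolding B_def mem_Collect_eq by (rule conjI[OF bH] exI conjI m(1) range pow)+
    moreover have "h = monomial f n w \<otimes> b"
      using h monomial_closed[of f, OF f(1)] by (simp add: b_def monomial_uminus[of f, OF f(1)])
    ultimately show ?thesis by blast
  qed
  show ?thesis
  proof (rule that[of "f ` {..<n} \<union> B"])
    show "finite (f ` {..<n} \<union> B)" using \<open>finite B\<close> by simp
    show "f ` {..<n} \<union> B \<subseteq> H" using f(1) by (auto simp: B_def)
    fix x y
    assume xy: "x \<in> carrier G" "y \<in> carrier G" and agree: "\<forall>g\<in>f ` {..<n} \<union> B. cj x g = cj y g"
    define z where "z = x \<otimes> inv y"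
    have zG: "z \<in> carrier G" using xy by (simp add: z_def)
    have cj_iff: "cj x g = cj y g \<longleftrightarrow> z \<otimes> g = g \<otimes> z" if "g \<in> carrier G" for g
      using cj_eq_iff[OF xy that] by (simp add: z_def)
    \<comment> \<open>Agreement of \<open>cj x\<close> and \<open>cj y\<close> at \<open>g\<close>
      means that \<open>g\<close> centralizes \<open>z\<close>, so it propagates from generators to
      \<open>H\<close>.\<close>
    define C where "C = {g \<in> carrier G. z \<otimes> g = g \<otimes> z}"
    have C_mult: "g \<otimes> h \<in> C" if "g \<in> C" "h \<in> C" for g h
    proof -
      have gh: "g \<in> carrier G" "h \<in> carrier G" "z \<otimes> g = g \<otimes> z" "z \<otimes> h = h \<otimes> z"
        using that by (auto simp: C_def)
      have "z \<otimes> (g \<otimes> h) = (g \<otimes> z) \<otimes> h" using gh(1,2) zG by (simp only: gh(3)[symmetric] m_assoc)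
      also have "\<dots> = g \<otimes> h \<otimes> z" using gh(1,2) zG by (simp only: gh(4) m_assoc)
      finally show ?thesis using gh by (simp add: C_def)
    qed
    have "subgroup C G"
    proof (rule subgroupI)
      show "C \<noteq> {}" using zG by (auto simp: C_def intro!: exI[of _ \<one>])
      show "inv g \<in> C" if "g \<in> C" for g using that zG commute_inv by (simp add: C_def)
    qed (use C_mult in \<open>auto simp: C_def\<close>)
    have f_C: "f i \<in> C" if "i < n" for i
      using agree that cj_iff[of "f i"] f(1)[of i] by (auto simp: C_def)
    have "monomial f k w \<in> C" if "k \<le> n" for k w
      using that
    proof (induction k)
      case 0
      then show ?case using \<open>subgroup C G\<close> by (simp add: subgroup.one_closed)
    next
      case (Suc k)
      then show ?case using f_C[of k] subgroup_int_pow_closed[OF \<open>subgroup C G\<close>] by (simp add: C_mult)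
    qed
    moreover have "B \<subseteq> C"
    proof
      fix g assume g: "g \<in> B"
      then have "g \<in> carrier G" by (auto simp: B_def)
      moreover have "cj x g = cj y g" using agree g by blast
      ultimately show "g \<in> C" using cj_iff by (simp add: C_def)
    qed
    ultimately have "H \<subseteq> C" using decomp C_mult by (metis order_refl subsetD subsetI)
    then show "\<forall>h\<in>H. cj x h = cj y h" using cj_iff by (auto simp: C_def)
  qed
qed

text \<open>Ultra summit conjugates of generators alone do not settle their products. So among the
  \<open>y\<close> good for \<open>F\<close>, one with a maximal set \<open>\<phi> y\<close> of good
  elements is taken; a maximum exists because \<open>\<phi> y\<close> depends only on the conjugates
  of \<open>F\<close>, which range over finite sets. If \<open>h\<close> were missing,
  \<open>H_ultra_step\<close> would enlarge \<open>\<phi> y\<close>.\<close>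

lemma simultaneous_ultra: "\<exists>y\<in>carrier G. \<forall>h\<in>H. y \<in> ultra_conjugators h"
proof -
  obtain F where F: "finite F" "F \<subseteq> H" and det:
    "\<And>x y. \<lbrakk>x \<in> carrier G; y \<in> carrier G; \<forall>g\<in>F. cj x g = cj y g\<rbrakk> \<Longrightarrow> \<forall>h\<in>H. cj x h = cj y h"
    using finite_determining_set by blast
  define Y where "Y = {y \<in> carrier G. \<forall>g\<in>F. y \<in> ultra_conjugators g}"
  define \<kappa> where "\<kappa> y = restrict (cj y) F" for y
  define \<phi> where "\<phi> y = {h \<in> H. y \<in> ultra_conjugators h}" for y
  have "Y \<noteq> {}" using finite_ultra[OF F] by (auto simp: Y_def)
  have "\<kappa> ` Y \<subseteq> (\<Pi>\<^sub>E g\<in>F. (\<lambda>x. cj x g) ` super_conjugators g)"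
    by (auto simp: \<kappa>_def Y_def intro!: imageI subsetD[OF ultra_conjugators_subset])
  moreover have "finite (\<Pi>\<^sub>E g\<in>F. (\<lambda>x. cj x g) ` super_conjugators g)"
    using F by (intro finite_PiE finite_conj_super_conjugators) auto
  ultimately have fin\<kappa>: "finite (\<kappa> ` Y)" using finite_subset by blast
  have \<phi>\<kappa>: "\<phi> x = \<phi> y" if "x \<in> Y" "y \<in> Y" "\<kappa> x = \<kappa> y" for x y
  proof -
    have G: "x \<in> carrier G" "y \<in> carrier G" using that by (auto simp: Y_def)
    have "cj x g = cj y g" if "g \<in> F" for g
      using fun_cong[OF \<open>\<kappa> x = \<kappa> y\<close>, of g] that by (simp add: \<kappa>_def)
    then have "\<forall>h\<in>H. cj x h = cj y h" using det[OF G] by blast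
    then have "x \<in> ultra_conjugators h \<longleftrightarrow> y \<in> ultra_conjugators h" if "h \<in> H" for h
      using that G ultra_summit_element_cj[of h x] ultra_summit_element_cj[of h y] by auto
    then show ?thesis by (auto simp: \<phi>_def)
  qed
  have "\<phi> ` Y \<subseteq> (\<lambda>k. \<phi> (inv_into Y \<kappa> k)) ` (\<kappa> ` Y)"
  proof (rule image_subsetI)
    fix y assume y: "y \<in> Y"
    then have "\<kappa> y \<in> \<kappa> ` Y" by (rule imageI)
    moreover from this have "\<phi> (inv_into Y \<kappa> (\<kappa> y)) = \<phi> y"
      by (intro \<phi>\<kappa> y inv_into_into f_inv_into_f)
    then have "\<phi> y = \<phi> (inv_into Y \<kappa> (\<kappa> y))" by (rule sym)
    ultimately show "\<phi> y \<in> (\<lambda>k. \<phi> (inv_into Y \<kappa> k)) ` (\<kappa> ` Y)"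
      by (rule_tac image_eqI[of "\<phi> y" "\<lambda>k. \<phi> (inv_into Y \<kappa> k)" "\<kappa> y"])
  qed
  then have "finite (\<phi> ` Y)" using fin\<kappa> finite_surj by blast
  then obtain y where y: "y \<in> Y" "\<And>x. x \<in> Y \<Longrightarrow> \<phi> y \<subseteq> \<phi> x \<Longrightarrow> \<phi> y = \<phi> x"
    using finite_has_maximal[of "\<phi> ` Y"] \<open>Y \<noteq> {}\<close> by blast
  have "y \<in> ultra_conjugators h" if h: "h \<in> H" for h
  proof -
    obtain x where x: "x \<in> ultra_conjugators h" "\<And>g. g \<in> H \<Longrightarrow> y \<in> ultra_conjugators g \<Longrightarrow> x \<in> ultra_conjugators g"
      using H_ultra_step[OF h, of y] y(1) by (auto simp: Y_def)
    have "x \<in> Y" using x y(1) F(2) ultra_conjugators_carrier[OF x(1)] by (auto simp: Y_def)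
    moreover have "\<phi> y \<subseteq> \<phi> x" using x(2) by (auto simp: \<phi>_def)
    ultimately have "\<phi> y = \<phi> x" by (rule y(2))
    then show ?thesis using x(1) h by (auto simp: \<phi>_def)
  qed
  then show ?thesis using y(1) by (auto simp: Y_def)
qed

end

section \<open>The trivial group and the conclusion\<close>

lemma (in garside_group) trivial_if_Delta_one:
  assumes "\<Delta> = \<one>"
  shows "carrier G = {\<one>}"
proof -
  have s1: "s = \<one>" if "s \<in> simples" for s
  proof -
    have s: "s \<in> P" "s \<preceq> \<one>" using that assms unfolding simples_iff by auto
    then show ?thesis by (intro P_units) (auto simp: le_iff)
  qed
  have "p = \<one>" if "p \<in> P" for p
    using that by (induction rule: P_induct) (auto dest: s1)
  note P1 = this
  have "g = \<one>" if g: "g \<in> carrier G" for g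
  proof -
    obtain a b where "a \<in> P" "b \<in> P" "g = inv a \<otimes> b" using fractions[OF g] by blast
    with P1[of a] P1[of b] show ?thesis by simp
  qed
  then show ?thesis by (intro equalityI subsetI) auto
qed

text \<open>Here \<open>inf_exp\<close> and \<open>sup_exp\<close> are unspecified integers, but the
  conjugacy class is a singleton, so the summit values agree with them. Only the empty factor list
  gives a normal form, and cycling fixes 1.\<close>

lemma (in garside_group) ultra_summit_element_trivial:
  assumes "carrier G = {\<one>}"
  shows "ultra_summit_element \<one>"
proof -
  have "conj_class \<one> = {\<one>}" using assms by (auto simp: conj_class_def)
  moreover have "normal_form \<one> 0 []" by (simp add: normal_form_def mprod_def)
  moreover have "ss = []" if "normal_form \<one> r ss" for r ss
  proof -
    have "simples \<subseteq> {\<one>}" using assms by auto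
    moreover have "set ss \<subseteq> simples - {\<one>, \<Delta>}" using that unfolding normal_form_def by blast
    ultimately have "s \<notin> set ss" for s by (metis DiffE insertI1 singletonD subsetD)
    then show ?thesis by (metis list.set_intros(1) neq_Nil_conv)
  qed
  ultimately have "cycling \<one> = \<one>"
    unfolding cycling_def by (intro the_equality) fastforce+
  then have "(cycling ^^ 1) \<one> = \<one>" by simp
  moreover have "summit_inf \<one> = inf_exp \<one>" "summit_sup \<one> = sup_exp \<one>"
    using \<open>conj_class \<one> = {\<one>}\<close> by (auto simp: summit_inf_def summit_sup_def intro!: Greatest_equality Least_equality)
  ultimately show ?thesis
    using \<open>conj_class \<one> = {\<one>}\<close>
    by (auto simp: ultra_summit_element_def ultra_summit_set_def super_summit_set_def intro: exI[of _ 1])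
qed

theorem theoremA:
  fixes G (structure) and P H :: "'a set" and \<Delta> :: 'a
  assumes "garside_group G P \<Delta>"
    and "subgroup H G"
    and "comm_group (G\<lparr>carrier := H\<rparr>)"
  shows "\<exists>g\<in>carrier G. \<forall>h \<in> (inv g <# H) #> g.
    garside_group.ultra_summit_element G P \<Delta> h"
proof -
  interpret garside_group G P \<Delta> by fact
  have coset: "\<exists>x\<in>H. h = cj g x" if "h \<in> (inv g <# H) #> g" for g h
    using that by (auto simp: l_coset_def r_coset_def cj_def)
  show ?thesis
  proof (cases "\<Delta> = \<one>")
    case True
    then have G: "carrier G = {\<one>}" by (rule trivial_if_Delta_one)
    have "h = \<one>" if "h \<in> (inv \<one> <# H) #> \<one>" for h
      using coset[OF that] subgroup.subset[OF assms(2)] G by auto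
    with ultra_summit_element_trivial[OF G] show ?thesis by (intro bexI[of _ \<one>]) auto
  next
    case False
    interpret abelian_subgroup G P \<Delta> H
    proof (intro abelian_subgroup.intro nontrivial_garside_group.intro
        abelian_subgroup_axioms.intro nontrivial_garside_group_axioms.intro)
      show "g \<otimes> h = h \<otimes> g" if "g \<in> H" "h \<in> H" for g h
        using comm_monoid.m_comm[OF comm_group.axioms(1)[OF assms(3)], of g h] that by simp
    qed (fact False assms)+
    obtain y where y: "y \<in> carrier G" "\<forall>h\<in>H. y \<in> ultra_conjugators h" using simultaneous_ultra by blast
    have "ultra_summit_element h" if "h \<in> (inv y <# H) #> y" for h
      using coset[OF that] y ultra_summit_element_cj by auto
    with y(1) show ?thesis by blast
  qed
qed

end
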